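(* Let $\varphi$ be a real-analytic function near $0$ with $\varphi(x)=\Phi x+O(x^2)$ as $x\to 0$, where $\Phi>0$, and consider the nonlinear Schrödinger equation with Dirichlet boundary conditions $$-i u_t+u_{xx}=\varphi(|u|^2)\,u,\qquad u(t,0)=u(t,\pi)=0. \qquad (\ast)$$ Let $m_0$ be any positive integer, and define $$a(t,x)=A\,e^{i m_0^2 t}e^{i m_0 x},\qquad A=\frac{m_0}{\sqrt 3},\qquad u_0(t,x)=a(t,x)-a(t,-x).$$ Then there are a constant $\varepsilon_0>0$ and a set $\mathcal E\subset[0,\varepsilon_0]$, both depending on $m_0$, with $$\lim_{\varepsilon\to 0^+}\frac{\mathrm{meas}(\mathcal E\cap[0,\varepsilon])}{\varepsilon}=1,$$ and constants $C,\kappa>0$, such that for all $\varepsilon\in\mathcal E$, setting $\omega_\varepsilon=1+\varepsilon$, there exists a solution $u_\varepsilon(t,x)$ of $(\ast)$ which is $2\pi/\omega_\varepsilon$-periodic in $t$, analytic in $(t,x)$, and satisfies $$\left\|u_\varepsilon(t,x)-\sqrt{\varepsilon/\Phi}\;u_0(\omega_\varepsilon t,x)\right\|_{\kappa}\le C\,\varepsilon\sqrt{\varepsilon}.$$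
   Context: Here $\mathrm{meas}$ is Lebesgue measure. For an analytic function $f(t,x)=\sum_{(n,m)\in\mathbb Z^2}f_{n,m}e^{int+imx}$, $2\pi$-periodic in both variables, and $r>0$, set $\|f\|_r=\sum_{(n,m)\in\mathbb Z^2}|f_{n,m}|e^{r(|n|+|m|)}$. Solutions are of the form $u(t,x)=\sum_{(n,m)\in\mathbb Z^2}u_{n,m}e^{in\omega_\varepsilon t+imx}$ with $u_{n,-m}=-u_{n,m}$ (thus extended to be odd and $2\pi$-periodic in $x$), and the norm $\|\cdot\|_\kappa$ of a function $F(\omega_\varepsilon t,x)$ with $F$ $2\pi$-periodic in both arguments is understood as $\|F\|_\kappa$, i.e. it is computed with the Fourier coefficients with respect to $e^{in\omega_\varepsilon t+imx}$. *)

theory Defs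
  imports "HOL-Analysis.Analysis" "HOL-Library.Landau_Symbols"
begin

definition real_analytic_on :: "(real \<Rightarrow> real) \<Rightarrow> real set \<Rightarrow> bool" where
  "real_analytic_on f S \<longleftrightarrow>
     (\<forall>x0\<in>S. \<exists>r>0. \<exists>c. \<forall>x. \<bar>x - x0\<bar> < r \<longrightarrow> (\<lambda>k. c k * (x - x0) ^ k) sums f x)"

definition jointly_analytic :: "(real \<Rightarrow> real \<Rightarrow> complex) \<Rightarrow> bool" where
  "jointly_analytic u \<longleftrightarrow>
     (\<forall>t0 x0. \<exists>r>0. \<exists>c. \<forall>t x. \<bar>t - t0\<bar> < r \<longrightarrow> \<bar>x - x0\<bar> < r \<longrightarrow>
        ((\<lambda>(j::nat, k::nat). c j k * of_real ((t - t0) ^ j * (x - x0) ^ k)) has_sum u t x) UNIV)"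

definition fourier_coeff :: "(real \<Rightarrow> real \<Rightarrow> complex) \<Rightarrow> int \<Rightarrow> int \<Rightarrow> complex" where
  "fourier_coeff F n m =
     integral {0..2 * pi} (\<lambda>t. integral {0..2 * pi} (\<lambda>x.
       F t x * exp (- \<i> * of_real (of_int n * t + of_int m * x)))) / of_real (4 * pi\<^sup>2)"

(* The sum is taken in ennreal, so that a divergent series has norm infinity
   and any finite upper bound entails convergence. *)
definition fourier_norm :: "real \<Rightarrow> (real \<Rightarrow> real \<Rightarrow> complex) \<Rightarrow> ennreal" where
  "fourier_norm r F =
     (\<Sum>\<^sub>\<infinity>(n, m)\<in>UNIV. ennreal (cmod (fourier_coeff F n m) * exp (r * of_int (\<bar>n\<bar> + \<bar>m\<bar>))))"

(* The norm of a function of the form F (w * t) x is that of F. *)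
definition freq_norm :: "real \<Rightarrow> real \<Rightarrow> (real \<Rightarrow> real \<Rightarrow> complex) \<Rightarrow> ennreal" where
  "freq_norm w r f = fourier_norm r (\<lambda>\<tau> x. f (\<tau> / w) x)"

definition odd_fourier_form :: "real \<Rightarrow> (real \<Rightarrow> real \<Rightarrow> complex) \<Rightarrow> bool" where
  "odd_fourier_form w u \<longleftrightarrow>
     (\<exists>U. (\<forall>n m. U n (- m) = - U n m) \<and>
          (\<forall>t x. ((\<lambda>(n::int, m::int).
              U n m * exp (\<i> * of_real (of_int n * w * t + of_int m * x))) has_sum u t x) UNIV))"

(* D is the domain on which \<phi> is considered: HOL functions are total, so a solution
   must be prevented from using the values of \<phi> outside D. The function u is taken on
   the whole real line in x (odd 2\<pi>-periodic extension), where the equation is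
   invariant under the extension. *)
definition dirichlet_nls_solution ::
  "(real \<Rightarrow> real) \<Rightarrow> real set \<Rightarrow> (real \<Rightarrow> real \<Rightarrow> complex) \<Rightarrow> bool" where
  "dirichlet_nls_solution \<phi> D u \<longleftrightarrow>
     (\<forall>t x. (cmod (u t x))\<^sup>2 \<in> D) \<and>
     (\<exists>ut ux uxx. \<forall>t x.
        ((\<lambda>s. u s x) has_vector_derivative ut t x) (at t) \<and>
        ((\<lambda>y. u t y) has_vector_derivative ux t x) (at x) \<and>
        ((\<lambda>y. ux t y) has_vector_derivative uxx t x) (at x) \<and>
        - \<i> * ut t x + uxx t x = of_real (\<phi> ((cmod (u t x))\<^sup>2)) * u t x) \<and>
     (\<forall>t. u t 0 = 0 \<and> u t pi = 0)"

definition wave_a :: "nat \<Rightarrow> real \<Rightarrow> real \<Rightarrow> complex" where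
  "wave_a m0 t x =
     of_real (real m0 / sqrt 3) * exp (\<i> * of_real ((real m0)\<^sup>2 * t)) * exp (\<i> * of_real (real m0 * x))"

definition wave_u0 :: "nat \<Rightarrow> real \<Rightarrow> real \<Rightarrow> complex" where
  "wave_u0 m0 t x = wave_a m0 t x - wave_a m0 t (- x)"

end

theory Submission
  imports Defs "HOL-Complex_Analysis.Complex_Analysis"
begin

text \<open>
  The nonlinearity is invariant under rotation of the phase, so one may look for solutions
  $u(t,x) = i e^{i m_0^2 \omega t} f(m_0 x)$ with $f$ real on the real line. With
  $\omega = 1 + \varepsilon$ and $\psi = \varphi / m_0^2$ the equation reduces to the conservative
  ordinary differential equation $f'' = (\psi(f^2) - \omega) f$, and the only requirement is that
  $f$ be odd and $2\pi$-periodic. No small divisors occur, and every small $\varepsilon > 0$ is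
  admissible: the set of frequencies is a full interval.

  Write $f = a \sin\Theta$ and $s = a^2$. Conservation of energy turns the equation into the first
  order equation $\Theta' = \sqrt{1 + \varepsilon - h_s(\sin^2\Theta)}$, where $h_s$ is the power
  series \<open>secant_series\<close>: $h_s(\sigma)$ is the mean of $\psi$ over the segment from
  $s\sigma$ to $s$, and it satisfies $h_s - (1 - \sigma) h_s' = \psi(s\sigma)$
  (\<open>secant_series_ode\<close>). The solution $\Theta$ is the inverse function of
  $Y(\theta) = \int_0^\theta (1 + \varepsilon - h_s(\sin^2))^{-1/2}$, so $f$ has period $2\pi$ as
  soon as $Y(2\pi) = 2\pi$. To first order $Y(2\pi)/2\pi = 1 - \varepsilon/2 + 3\beta s/8$ with
  $\beta = \psi'(0)$, and the intermediate value theorem yields such an $s$ with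
  $s = 4\varepsilon/(3\beta) + O(\varepsilon^2)$ (\<open>amplitude_exists\<close>). The value
  $4\varepsilon/(3\beta)$ is the squared amplitude of the wave $\sqrt{\varepsilon/\Phi}\, u_0$.

  Everything extends to a complex strip around the real line: $Y$ is a periodic perturbation of
  size $O(\varepsilon)$ of the identity, hence has a holomorphic inverse on a smaller strip
  (\<open>perturbed_identity_inverse\<close>), and $f$ differs there from the sine wave by
  $O(\varepsilon^{3/2})$ (\<open>profile_exists\<close>). Moving the line of integration inside the
  strip turns this sup-norm bound into exponential decay of Fourier coefficients
  (\<open>fcoeff_decay\<close>), which is the asserted estimate. That the Fourier series converges to
  the function follows from the telescoping identity for the quotient
  $(f(z) - f(0))/(e^{iz} - 1)$ (\<open>fourier_series\<close>).
\<close>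

section \<open>Fourier series of periodic holomorphic functions on a strip\<close>

text \<open>
  The open horizontal strip of half-width \<open>\<rho>\<close> around the real axis.
\<close>
definition strip :: "real \<Rightarrow> complex set" where
  "strip \<rho> = {z. \<bar>Im z\<bar> < \<rho>}"

lemma strip_iff [simp]: "z \<in> strip \<rho> \<longleftrightarrow> \<bar>Im z\<bar> < \<rho>"
  by (simp add: strip_def)

lemma open_strip [simp]: "open (strip \<rho>)"
  unfolding strip_def by (intro open_Collect_less continuous_intros)

lemma convex_strip [simp]: "convex (strip \<rho>)"
proof -
  have "strip \<rho> = {z. Im z < \<rho>} \<inter> {z. - \<rho> < Im z}"
    by (auto simp: strip_def)
  then show ?thesis
    by (simp add: convex_Int convex_halfspace_Im_lt convex_halfspace_Im_gt)
qed

lemma holomorphic_strip_primitive: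
  assumes "f holomorphic_on strip \<rho>"
  obtains G where "\<And>z. z \<in> strip \<rho> \<Longrightarrow> (G has_field_derivative f z) (at z)"
  using holomorphic_convex_primitive'[OF convex_strip open_strip assms] at_within_open[OF _ open_strip]
  by metis

text \<open>
  A primitive of a periodic function grows by the same amount over each period, also when the
  period is translated off the real axis. This replaces contour shifts along rectangles.
\<close>
lemma period_increment_of_primitive:
  assumes G: "\<And>z. z \<in> strip \<rho> \<Longrightarrow> (G has_field_derivative f z) (at z)"
    and per: "\<And>z. z \<in> strip \<rho> \<Longrightarrow> f (z + of_real p) = f z"
    and z: "z \<in> strip \<rho>" and w: "w \<in> strip \<rho>"
  shows "G (z + of_real p) - G z = G (w + of_real p) - G w"
proof -
  have "((\<lambda>z. G (z + of_real p) - G z) has_field_derivative 0) (at z within strip \<rho>)"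
    if "z \<in> strip \<rho>" for z
  proof -
    have "(G has_field_derivative f z) (at (z + of_real p))"
      using G[of "z + of_real p"] per[OF that] that by simp
    then have "((\<lambda>z. G (z + of_real p)) has_field_derivative f z) (at z)"
      by (subst (asm) DERIV_shift) simp
    from DERIV_diff[OF this G[OF that]] show ?thesis
      by (simp add: has_field_derivative_at_within)
  qed
  from has_field_derivative_zero_constant[OF convex_strip this]
  show ?thesis using z w by metis
qed

lemma integral_eq_primitive_increment:
  fixes f G :: "complex \<Rightarrow> complex"
  assumes "a \<le> b"
    and G: "\<And>x. x \<in> {a..b} \<Longrightarrow> (G has_field_derivative f (w + of_real x)) (at (w + of_real x))"
  shows "((\<lambda>x. f (w + of_real x)) has_integral (G (w + of_real b) - G (w + of_real a))) {a..b}"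
proof (rule fundamental_theorem_of_calculus[OF assms(1)])
  fix x assume x: "x \<in> {a..b}"
  have "((\<lambda>x. w + complex_of_real x) has_vector_derivative 1) (at x within {a..b})"
    by (auto intro!: derivative_eq_intros)
  from field_vector_diff_chain_within[OF this, of G "f (w + of_real x)"] G[OF x]
  show "((\<lambda>x. G (w + of_real x)) has_vector_derivative f (w + of_real x)) (at x within {a..b})"
    by (simp add: o_def has_field_derivative_at_within)
qed

lemma periodic_integral_shift:
  assumes hol: "f holomorphic_on strip \<rho>"
    and per: "\<And>z. z \<in> strip \<rho> \<Longrightarrow> f (z + of_real (2*pi)) = f z"
    and w: "w \<in> strip \<rho>"
  shows "((\<lambda>x. f (w + of_real x)) has_integral (integral {0..2*pi} (\<lambda>x. f (of_real x)))) {0..2*pi}"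
proof -
  obtain G where G: "\<And>z. z \<in> strip \<rho> \<Longrightarrow> (G has_field_derivative f z) (at z)"
    using holomorphic_strip_primitive[OF hol] by blast
  have "\<rho> > 0" using w by auto
  have I: "((\<lambda>x. f (z + of_real x)) has_integral (G (z + of_real (2*pi)) - G z)) {0..2*pi}"
    if "z \<in> strip \<rho>" for z
    using integral_eq_primitive_increment[of 0 "2*pi" G f z] G that by simp
  have "integral {0..2*pi} (\<lambda>x. f (of_real x)) = G (0 + of_real (2*pi)) - G 0"
    using I[of 0] \<open>\<rho> > 0\<close> by (simp add: integral_unique)
  also have "\<dots> = G (w + of_real (2*pi)) - G w"
    by (rule period_increment_of_primitive[of \<rho> G f "2*pi"]) (use G per w \<open>\<rho> > 0\<close> in auto)
  finally show ?thesis using I[OF w] by simp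
qed

text \<open>
  The Fourier coefficient of index \<open>m\<close> of the restriction to the real line of a
  function that is $2\pi$-periodic there.
\<close>
definition fcoeff :: "(complex \<Rightarrow> complex) \<Rightarrow> int \<Rightarrow> complex" where
  "fcoeff f m = integral {0..2*pi} (\<lambda>x. f (of_real x) * exp (- \<i> * of_int m * of_real x)) / of_real (2*pi)"

lemma exp_int_periodic: "exp (- \<i> * of_int m * (z + of_real (2*pi))) = exp (- \<i> * of_int m * z)"
proof -
  have "exp (- \<i> * of_int m * (z + of_real (2*pi))) = exp (- \<i> * of_int m * z) * exp ((2 * of_int (- m) * of_real pi) * \<i>)"
    unfolding exp_add[symmetric] by (rule arg_cong[where f=exp]) (simp add: ring_distribs)
  also have "exp ((2 * of_int (- m) * of_real pi) * \<i>) = 1"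
    using exp_integer_2pi[of "of_int (- m)"] by simp
  finally show ?thesis by simp
qed

text \<open>
  Holomorphic functions on a strip that are periodic with period $2\pi$.
\<close>
locale periodic_on_strip =
  fixes f :: "complex \<Rightarrow> complex" and \<rho> :: real
  assumes pos: "\<rho> > 0"
    and hol: "f holomorphic_on strip \<rho>"
    and per: "\<And>z. z \<in> strip \<rho> \<Longrightarrow> f (z + of_real (2*pi)) = f z"
begin

lemma fcoeff_integral:
  assumes "w \<in> strip \<rho>"
  shows "((\<lambda>x. f (w + of_real x) * exp (- \<i> * of_int m * (w + of_real x)))
           has_integral (of_real (2*pi) * fcoeff f m)) {0..2*pi}"
proof -
  have "of_real (2*pi) * fcoeff f m = integral {0..2*pi} (\<lambda>x. f (of_real x) * exp (- \<i> * of_int m * of_real x))"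
    by (simp add: fcoeff_def)
  moreover have "(\<lambda>z. f z * exp (- \<i> * of_int m * z)) holomorphic_on strip \<rho>"
    by (intro holomorphic_intros hol)
  ultimately show ?thesis
    using periodic_integral_shift[of "\<lambda>z. f z * exp (- \<i> * of_int m * z)" \<rho> w] assms
    by (metis per exp_int_periodic)
qed

text \<open>
  Integrating along the line of height \<open>c\<close> instead of the real line gains the
  factor $e^{mc}$.
\<close>
lemma fcoeff_bound:
  assumes c: "\<bar>c\<bar> < \<rho>" and B: "\<And>x. x \<in> {0..2*pi} \<Longrightarrow> cmod (f (Complex x c)) \<le> B"
  shows "cmod (fcoeff f m) \<le> B * exp (m * c)"
proof -
  have C: "Complex 0 c + of_real x = Complex x c" for x
    by (simp add: complex_eq_iff)
  have B0: "B \<ge> 0" using B[of 0] by (meson atLeastAtMost_iff norm_ge_zero order_trans pi_ge_zero order_refl mult_nonneg_nonneg zero_le_numeral)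
  have "cmod (of_real (2*pi) * fcoeff f m) \<le> (B * exp (m * c)) * measure lborel (cbox 0 (2*pi))"
  proof (rule has_integral_bound)
    show "((\<lambda>x. f (Complex x c) * exp (- \<i> * of_int m * Complex x c))
           has_integral (of_real (2*pi) * fcoeff f m)) (cbox 0 (2*pi))"
      using fcoeff_integral[of "Complex 0 c" m] c by (simp add: C)
    show "cmod (f (Complex x c) * exp (- \<i> * of_int m * Complex x c)) \<le> B * exp (m * c)"
      if "x \<in> cbox 0 (2*pi)" for x
      using B[of x] that by (simp add: norm_mult)
  qed (use B0 in auto)
  then show ?thesis by (simp add: norm_mult)
qed

lemma fcoeff_decay:
  assumes c: "0 \<le> c" "c < \<rho>" and B: "\<And>z. \<bar>Im z\<bar> = c \<Longrightarrow> cmod (f z) \<le> B"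
  shows "cmod (fcoeff f m) \<le> B * exp (- c * \<bar>m\<bar>)"
proof (cases "m \<ge> 0")
  case True
  then show ?thesis using fcoeff_bound[of "-c" B m] c B by (simp add: mult.commute)
next
  case False
  then show ?thesis using fcoeff_bound[of "c" B m] c B by (simp add: mult.commute)
qed

lemma bounded_on_line:
  assumes c: "\<bar>c\<bar> < \<rho>"
  obtains B where "\<And>x. x \<in> {0..2*pi} \<Longrightarrow> cmod (f (Complex x c)) \<le> B"
proof -
  have "continuous_on {0..2*pi} (\<lambda>x. f (of_real x + Complex 0 c))"
    using c by (intro continuous_on_compose2[OF holomorphic_on_imp_continuous_on[OF hol]] continuous_intros) auto
  then have "bounded ((\<lambda>x. f (of_real x + Complex 0 c)) ` {0..2*pi})"
    by (intro compact_imp_bounded compact_continuous_image) auto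
  moreover have "of_real x + Complex 0 c = Complex x c" for x
    by (simp add: complex_eq_iff)
  ultimately show ?thesis using that by (fastforce simp: bounded_iff simp del: atLeastAtMost_iff)
qed

lemma fcoeff_decay_ex:
  assumes "0 \<le> c" "c < \<rho>"
  obtains B where "\<And>m. cmod (fcoeff f m) \<le> B * exp (- c * \<bar>m\<bar>)"
proof -
  obtain B1 where B1: "\<And>x. x \<in> {0..2*pi} \<Longrightarrow> cmod (f (Complex x c)) \<le> B1"
    using bounded_on_line[of c] assms by force
  obtain B2 where B2: "\<And>x. x \<in> {0..2*pi} \<Longrightarrow> cmod (f (Complex x (-c))) \<le> B2"
    using bounded_on_line[of "-c"] assms by force
  show ?thesis
  proof (rule that)
    fix m
    show "cmod (fcoeff f m) \<le> max B1 B2 * exp (- c * \<bar>m\<bar>)"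
    proof (cases "m \<ge> 0")
      case True
      then show ?thesis using fcoeff_bound[of "-c" "max B1 B2" m] assms B2 by (simp add: mult.commute le_max_iff_disj)
    next
      case False
      then show ?thesis using fcoeff_bound[of "c" "max B1 B2" m] assms B1 by (simp add: mult.commute le_max_iff_disj)
    qed
  qed
qed

lemma fcoeff_shift:
  "fcoeff (\<lambda>z. f (z + of_real x0)) m = exp (\<i> * of_int m * of_real x0) * fcoeff f m"
proof -
  have "((\<lambda>x. exp (\<i> * of_int m * of_real x0) * (f (of_real x0 + of_real x) * exp (- \<i> * of_int m * (of_real x0 + of_real x))))
           has_integral exp (\<i> * of_int m * of_real x0) * (of_real (2*pi) * fcoeff f m)) {0..2*pi}"
    by (intro has_integral_mult_right fcoeff_integral) (use pos in auto)
  moreover have "exp (\<i> * of_int m * of_real x0) * (f (of_real x0 + of_real x) * exp (- \<i> * of_int m * (of_real x0 + of_real x)))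
    = f (of_real x + of_real x0) * exp (- \<i> * of_int m * of_real x)" for x
  proof -
    have "exp (\<i> * of_int m * of_real x0) * exp (- \<i> * of_int m * (of_real x0 + of_real x)) = exp (- \<i> * of_int m * of_real x)"
      by (simp add: exp_add[symmetric] algebra_simps)
    then show ?thesis by (simp add: ac_simps)
  qed
  ultimately have "((\<lambda>x. f (of_real x + of_real x0) * exp (- \<i> * of_int m * of_real x))
     has_integral exp (\<i> * of_int m * of_real x0) * (of_real (2*pi) * fcoeff f m)) {0..2*pi}"
    by simp
  then show ?thesis
    by (simp add: fcoeff_def integral_unique)
qed

lemma deriv_periodic:
  assumes "z \<in> strip \<rho>" shows "deriv f (z + of_real (2*pi)) = deriv f z"
proof -
  have "(f has_field_derivative deriv f (z + of_real (2*pi))) (at (z + of_real (2*pi)))"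
    using hol assms by (intro holomorphic_derivI[OF _ open_strip]) auto
  then have "((\<lambda>w. f (w + of_real (2*pi))) has_field_derivative deriv f (z + of_real (2*pi))) (at z)"
    by (simp add: DERIV_shift)
  then have "(f has_field_derivative deriv f (z + of_real (2*pi))) (at z)"
    by (rule has_field_derivative_transform_within_open[OF _ open_strip assms]) (use per in auto)
  then show ?thesis by (simp add: DERIV_imp_deriv)
qed

end

lemma exp_i_eq_1_iff: "exp (\<i> * z) = 1 \<longleftrightarrow> (\<exists>n::int. z = of_real (2 * pi) * of_int n)"
proof -
  have "exp (\<i> * z) = 1 \<longleftrightarrow> Im z = 0 \<and> (\<exists>n::int. Re z = of_int (2 * n) * pi)"
    by (simp add: exp_eq_1)
  also have "\<dots> \<longleftrightarrow> (\<exists>n::int. z = of_real (2 * pi) * of_int n)"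
    by (auto simp: complex_eq_iff mult_ac)
  finally show ?thesis .
qed

lemma summable_int_exp:
  fixes c :: real
  assumes "c > 0"
  shows "(\<lambda>m::int. exp (- c * \<bar>m\<bar>)) summable_on UNIV"
proof -
  have "(\<lambda>n::nat. exp (- c) ^ n) summable_on UNIV"
    using assms by (intro norm_summable_imp_summable_on) (simp add: summable_geometric)
  then have N: "(\<lambda>n::nat. exp (- c * real n)) summable_on UNIV"
    by (simp only: exp_of_nat2_mult)
  have 1: "(\<lambda>m::int. exp (- c * \<bar>m\<bar>)) summable_on (range int)"
    using N by (subst summable_on_reindex) (auto simp: o_def)
  have 2: "(\<lambda>m::int. exp (- c * \<bar>m\<bar>)) summable_on (range (\<lambda>n. - int n))"
    using N by (subst summable_on_reindex) (auto simp: o_def inj_on_def)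
  have "m \<in> range int \<union> range (\<lambda>n. - int n)" for m
    by (cases m rule: int_cases2) auto
  then have "range int \<union> range (\<lambda>n. - int n) = UNIV"
    by blast
  then show ?thesis
    using summable_on_union[OF 1 2] by simp
qed

lemma has_integral_exp_int:
  "((\<lambda>x. exp (- \<i> * of_int m * of_real x)) has_integral (if m = 0 then of_real (2*pi) else 0)) {0..2*pi}"
proof (cases "m = 0")
  case True
  then show ?thesis using has_integral_const_real[of "1::complex" 0 "2*pi"] by (simp add: scaleR_conv_of_real)
next
  case False
  have "((\<lambda>z. exp (- \<i> * of_int m * z) / (- \<i> * of_int m)) has_field_derivative exp (- \<i> * of_int m * z)) (at z)" for z
    using False by (auto intro!: derivative_eq_intros)
  note d = this
  have "((\<lambda>x. exp (- \<i> * of_int m * (0 + of_real x))) has_integral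
      (exp (- \<i> * of_int m * (0 + of_real (2*pi))) / (- \<i> * of_int m) - exp (- \<i> * of_int m * (0 + of_real 0)) / (- \<i> * of_int m))) {0..2*pi}"
    by (rule integral_eq_primitive_increment[where f = "\<lambda>z. exp (- \<i> * of_int m * z)"
        and G = "\<lambda>z. exp (- \<i> * of_int m * z) / (- \<i> * of_int m)" and w = 0]) (simp_all only: d, simp)
  then show ?thesis
    unfolding exp_int_periodic using False by simp
qed

context periodic_on_strip begin

lemma per_nat: "z \<in> strip \<rho> \<Longrightarrow> f (z + of_real (2*pi) * of_nat n) = f z"
proof (induction n)
  case (Suc n)
  have "f (z + of_real (2*pi) * of_nat (Suc n)) = f ((z + of_real (2*pi) * of_nat n) + of_real (2*pi))"
    by (simp add: algebra_simps)
  also have "\<dots> = f (z + of_real (2*pi) * of_nat n)"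
    using Suc.prems by (intro per) simp
  finally show ?case using Suc by simp
qed simp

lemma per_int: assumes "z \<in> strip \<rho>" shows "f (z + of_real (2*pi) * of_int n) = f z"
proof (cases "n \<ge> 0")
  case True
  then obtain k where "n = int k" using nonneg_int_cases by blast
  then show ?thesis using per_nat[OF assms, of k] by simp
next
  case False
  then obtain k where k: "n = - int k" using int_cases2[of n] by force
  have "f ((z + of_real (2*pi) * of_int n) + of_real (2*pi) * of_nat k) = f (z + of_real (2*pi) * of_int n)"
    using assms by (intro per_nat) simp
  then show ?thesis by (simp add: k)
qed

text \<open>
  The quotient $(f(z) - f(0))/(e^{iz} - 1)$ with its removable singularities at the multiples of
  $2\pi$ filled in. The derivative of $e^{iz}$ at these points is \<open>\<i>\<close>.
\<close>
definition chernoff_quotient :: "complex \<Rightarrow> complex" where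
  "chernoff_quotient z = (if exp (\<i> * z) = 1 then deriv f z / \<i> else (f z - f 0) / (exp (\<i> * z) - 1))"

lemma chernoff_quotient_eq:
  assumes "z \<in> strip \<rho>"
  shows "(exp (\<i> * z) - 1) * chernoff_quotient z = f z - f 0"
proof (cases "exp (\<i> * z) = 1")
  case True
  then obtain n where "z = of_real (2 * pi) * of_int n" by (auto simp: exp_i_eq_1_iff)
  then have "f z = f 0" using per_int[of 0 n] pos by simp
  then show ?thesis by (simp add: True)
qed (simp add: chernoff_quotient_def)

lemma chernoff_quotient_holomorphic: "chernoff_quotient holomorphic_on strip \<rho>"
proof -
  have "chernoff_quotient field_differentiable at a" if a: "a \<in> strip \<rho>" for a
  proof (cases "exp (\<i> * a) = 1")
    case False
    define S where "S = strip \<rho> \<inter> {z. exp (\<i> * z) \<noteq> 1}"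
    have "open S" unfolding S_def
      by (intro open_Int open_strip open_Collect_neq continuous_intros)
    moreover have "(\<lambda>z. (f z - f 0) / (exp (\<i> * z) - 1)) holomorphic_on S"
      by (intro holomorphic_intros holomorphic_on_subset[OF hol]) (auto simp: S_def)
    then have "chernoff_quotient holomorphic_on S"
      by (rule holomorphic_transform) (simp add: S_def chernoff_quotient_def)
    moreover have "a \<in> S" using a False by (simp add: S_def)
    ultimately show ?thesis by (simp add: holomorphic_on_imp_differentiable_at)
  next
    case True
    then obtain n where n: "a = of_real (2 * pi) * of_int n" by (auto simp: exp_i_eq_1_iff)
    have fa: "f a = f 0" using per_int[of 0 n] pos n by simp
    \<comment> \<open>Distinct multiples of $2\pi$ are further than 1 apart, so \<open>a\<close> is the only singular point in this ball, and the quotient of the two difference quotients at \<open>a\<close> is holomorphic there.\<close>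
    define S where "S = strip \<rho> \<inter> ball a 1"
    have only: "z = a" if "z \<in> S" "exp (\<i> * z) = 1" for z
    proof -
      obtain k where k: "z = of_real (2 * pi) * of_int k" using \<open>exp (\<i> * z) = 1\<close> by (auto simp: exp_i_eq_1_iff)
      have "z - a = of_real (2 * pi) * of_int (k - n)" by (simp add: k n algebra_simps)
      then have "cmod (z - a) = 2 * pi * \<bar>k - n\<bar>" by (simp add: norm_mult del: of_int_diff)
      moreover have "cmod (z - a) < 1" using that by (simp add: S_def dist_norm norm_minus_commute)
      ultimately have "2 * pi * \<bar>k - n\<bar> < 1" by simp
      moreover have "2 * pi * \<bar>k - n\<bar> \<ge> 1" if "k \<noteq> n"
      proof -
        have "1 * 1 \<le> (2 * pi) * real_of_int \<bar>k - n\<bar>" using that pi_gt3 by (intro mult_mono) auto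
        then show ?thesis by simp
      qed
      ultimately show "z = a" using k n by force
    qed
    define Qf where "Qf = (\<lambda>z. if z = a then deriv f a else (f z - f a) / (z - a))"
    define e :: "complex \<Rightarrow> complex" where "e = (\<lambda>z. exp (\<i> * z))"
    define Qe where "Qe = (\<lambda>z. if z = a then deriv e a else (e z - e a) / (z - a))"
    have "(e has_field_derivative \<i>) (at a)"
      using True by (auto simp: e_def intro!: derivative_eq_intros)
    then have de: "deriv e a = \<i>" by (rule DERIV_imp_deriv)
    have 1: "Qf holomorphic_on S"
      unfolding Qf_def by (intro holomorphic_on_subset[OF pole_lemma_open[OF hol open_strip]]) (auto simp: S_def)
    have "e holomorphic_on UNIV" by (simp add: e_def holomorphic_intros)
    then have 2: "Qe holomorphic_on S"
      unfolding Qe_def by (intro holomorphic_on_subset[OF pole_lemma_open]) auto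
    have ea: "e a = 1" and ne: "e z \<noteq> 1" if "z \<in> S" "z \<noteq> a" for z
      using True only[OF that(1)] that(2) by (auto simp: e_def)
    have 3: "Qe z \<noteq> 0" if "z \<in> S" for z
    proof (cases "z = a")
      case False
      then show ?thesis using ea[OF that False] ne[OF that False] by (simp add: Qe_def)
    qed (simp add: Qe_def de)
    have "chernoff_quotient holomorphic_on S"
    proof (rule holomorphic_transform)
      show "(\<lambda>z. Qf z / Qe z) holomorphic_on S" using 1 2 3 by (intro holomorphic_intros)
      show "Qf z / Qe z = chernoff_quotient z" if "z \<in> S" for z
      proof (cases "z = a")
        case False
        then have "exp (\<i> * z) \<noteq> 1" using only[OF that] by blast
        then show ?thesis using False ea[OF that False] fa by (simp add: Qe_def Qf_def e_def chernoff_quotient_def)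
      qed (simp add: Qe_def Qf_def de True chernoff_quotient_def)
    qed
    moreover have "open S" "a \<in> S" using a by (auto simp: S_def)
    ultimately show ?thesis by (simp add: holomorphic_on_imp_differentiable_at)
  qed
  then show ?thesis by (simp add: holomorphic_on_open field_differentiable_def)
qed

lemma chernoff_quotient_periodic: "periodic_on_strip chernoff_quotient \<rho>"
proof
  fix z assume z: "z \<in> strip \<rho>"
  have "exp (\<i> * (z + of_real (2*pi))) = exp (\<i> * z)"
    using exp_int_periodic[of "-1" z] by simp
  then show "chernoff_quotient (z + of_real (2*pi)) = chernoff_quotient z"
    unfolding chernoff_quotient_def using per[OF z] deriv_periodic[OF z] by simp
qed (use pos chernoff_quotient_holomorphic in auto)

text \<open>
  Multiplication by $e^{iz} - 1$ acts on Fourier coefficients as a difference operator. The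
  partial sums of the Fourier series of \<open>f\<close> at 0 therefore telescope, up to
  coefficients of the quotient that tend to 0.
\<close>
lemma fcoeff_telescope:
  "fcoeff f m = (if m = 0 then f 0 else 0) + (fcoeff chernoff_quotient (m - 1) - fcoeff chernoff_quotient m)"
proof -
  let ?g = chernoff_quotient
  interpret g: periodic_on_strip ?g \<rho> by (rule chernoff_quotient_periodic)
  have "((\<lambda>x. f 0 * exp (- \<i> * of_int m * of_real x)
          + (?g (0 + of_real x) * exp (- \<i> * of_int (m - 1) * (0 + of_real x))
             - ?g (0 + of_real x) * exp (- \<i> * of_int m * (0 + of_real x))))
     has_integral (f 0 * (if m = 0 then of_real (2*pi) else 0)
        + (of_real (2*pi) * fcoeff ?g (m - 1) - of_real (2*pi) * fcoeff ?g m))) {0..2*pi}"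
    by (intro has_integral_add has_integral_diff has_integral_mult_right has_integral_exp_int g.fcoeff_integral) (use pos in auto)
  moreover have "f 0 * exp (- \<i> * of_int m * of_real x)
          + (?g (0 + of_real x) * exp (- \<i> * of_int (m - 1) * (0 + of_real x))
             - ?g (0 + of_real x) * exp (- \<i> * of_int m * (0 + of_real x)))
       = f (of_real x) * exp (- \<i> * of_int m * of_real x)" for x
  proof -
    have "exp (- \<i> * of_int (m - 1) * of_real x) = exp (\<i> * of_real x) * exp (- \<i> * of_int m * of_real x)"
      unfolding exp_add[symmetric] by (rule arg_cong[where f = exp]) (simp add: algebra_simps)
    note 1 = this
    have 2: "f (of_real x) = f 0 + (exp (\<i> * of_real x) - 1) * ?g (of_real x)"
      using chernoff_quotient_eq[of "of_real x"] pos by simp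
    show ?thesis unfolding add_0 1 2 by (simp only: ring_distribs mult_1_left mult_ac)
  qed
  ultimately have "((\<lambda>x. f (of_real x) * exp (- \<i> * of_int m * of_real x))
     has_integral (f 0 * (if m = 0 then of_real (2*pi) else 0)
        + (of_real (2*pi) * fcoeff ?g (m - 1) - of_real (2*pi) * fcoeff ?g m))) {0..2*pi}"
    by simp
  then show ?thesis
    by (simp add: fcoeff_def[of f] integral_unique add_divide_distrib diff_divide_distrib)
qed

lemma fcoeff_summable: "(\<lambda>m. cmod (fcoeff f m)) summable_on UNIV"
proof -
  obtain B where B: "\<And>m. cmod (fcoeff f m) \<le> B * exp (- (\<rho>/2) * \<bar>m\<bar>)"
    using fcoeff_decay_ex[of "\<rho>/2"] pos by auto
  have "(\<lambda>m::int. B * exp (- (\<rho>/2) * \<bar>m\<bar>)) summable_on UNIV"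
    using pos by (intro summable_on_cmult_right[OF summable_int_exp[of "\<rho>/2"]]) simp
  then show ?thesis
    by (rule summable_on_comparison_test) (use B in auto)
qed

lemma fcoeff_tendsto_0:
  "((\<lambda>n. fcoeff f (int n)) \<longlongrightarrow> 0) sequentially" "((\<lambda>n. fcoeff f (- int n)) \<longlongrightarrow> 0) sequentially"
proof -
  obtain B where B: "\<And>m. cmod (fcoeff f m) \<le> B * exp (- (\<rho>/2) * \<bar>m\<bar>)"
    using fcoeff_decay_ex[of "\<rho>/2"] pos by auto
  have "(\<lambda>n. exp (- (\<rho>/2)) ^ n) \<longlonglongrightarrow> 0" using pos by (intro LIMSEQ_power_zero) auto
  then have "(\<lambda>n::nat. B * exp (- (\<rho>/2) * n)) \<longlonglongrightarrow> 0"
    by (intro tendsto_mult_right_zero) (simp only: exp_of_nat2_mult)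
  note lim = this
  have 1: "\<forall>n. cmod (fcoeff f (int n)) \<le> B * exp (- (\<rho>/2) * n)"
    using B by (metis abs_of_nat of_int_of_nat_eq)
  have 2: "\<forall>n. cmod (fcoeff f (- int n)) \<le> B * exp (- (\<rho>/2) * n)"
    using B by (metis abs_of_nat abs_minus_cancel of_int_of_nat_eq)
  show "((\<lambda>n. fcoeff f (int n)) \<longlongrightarrow> 0) sequentially"
    by (rule Lim_null_comparison[OF always_eventually[OF 1] lim])
  show "((\<lambda>n. fcoeff f (- int n)) \<longlongrightarrow> 0) sequentially"
    by (rule Lim_null_comparison[OF always_eventually[OF 2] lim])
qed

lemma fourier_sum_at_0: "(fcoeff f has_sum f 0) UNIV"
proof -
  let ?g = chernoff_quotient
  interpret g: periodic_on_strip ?g \<rho> by (rule chernoff_quotient_periodic)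
  have part: "(\<Sum>m = - int N..int N. fcoeff f m) = f 0 + (fcoeff ?g (- int (Suc N)) - fcoeff ?g (int N))" for N
  proof (induction N)
    case 0
    then show ?case using fcoeff_telescope[of 0] by simp
  next
    case (Suc N)
    have "{- int (Suc N)..int (Suc N)} = insert (int (Suc N)) (insert (- int (Suc N)) {- int N..int N})" by auto
    then have "(\<Sum>m = - int (Suc N)..int (Suc N). fcoeff f m) = fcoeff f (int (Suc N)) + (fcoeff f (- int (Suc N)) + (\<Sum>m = - int N..int N. fcoeff f m))"
      by simp
    then show ?case
      unfolding Suc using fcoeff_telescope[of "int (Suc N)"] fcoeff_telescope[of "- int (Suc N)"] by simp
  qed
  obtain S where S: "(fcoeff f has_sum S) UNIV"
    using abs_summable_summable[OF fcoeff_summable] by (auto simp: summable_on_def)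
  have lim: "filterlim (\<lambda>N. {- int N..int N}) (finite_subsets_at_top UNIV) sequentially"
    unfolding filterlim_finite_subsets_at_top
  proof safe
    fix X :: "int set" assume "finite X"
    define M where "M = nat (Max (insert 0 (abs ` X)))"
    have "\<bar>x\<bar> \<le> int M" if "x \<in> X" for x
    proof -
      have "\<bar>x\<bar> \<le> Max (insert 0 (abs ` X))" using that \<open>finite X\<close> by (intro Max_ge) auto
      then show ?thesis unfolding M_def by linarith
    qed
    then have "X \<subseteq> {- int N..int N}" if "N \<ge> M" for N
      using that by (force simp: abs_le_iff)
    then show "\<forall>\<^sub>F N in sequentially. finite {- int N..int N} \<and> X \<subseteq> {- int N..int N} \<and> {- int N..int N} \<subseteq> UNIV"
      by (auto simp: eventually_sequentially)
  qed
  have "(\<lambda>N. \<Sum>m = - int N..int N. fcoeff f m) \<longlonglongrightarrow> S"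
    using S lim unfolding has_sum_def by (rule filterlim_compose)
  moreover have "(\<lambda>N. f 0 + (fcoeff ?g (- int (Suc N)) - fcoeff ?g (int N))) \<longlonglongrightarrow> f 0 + (0 - 0)"
    by (intro tendsto_intros g.fcoeff_tendsto_0 LIMSEQ_Suc[OF g.fcoeff_tendsto_0(2)])
  ultimately have "S = f 0" unfolding part using LIMSEQ_unique by fastforce
  with S show ?thesis by simp
qed

lemma fourier_series:
  "((\<lambda>m. fcoeff f m * exp (\<i> * of_int m * of_real x)) has_sum f (of_real x)) UNIV"
proof -
  have "periodic_on_strip (\<lambda>z. f (z + of_real x)) \<rho>"
  proof
    show "(\<lambda>z. f (z + of_real x)) holomorphic_on strip \<rho>"
      by (intro holomorphic_on_compose_gen[OF _ hol, unfolded o_def] holomorphic_intros) auto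
    show "f (z + of_real (2*pi) + of_real x) = f (z + of_real x)" if "z \<in> strip \<rho>" for z
      using per[of "z + of_real x"] that by (simp add: add_ac)
  qed (rule pos)
  from periodic_on_strip.fourier_sum_at_0[OF this] show ?thesis
    unfolding fcoeff_shift by (simp add: mult.commute)
qed

end

section \<open>Secant slopes of a power series\<close>

text \<open>
  The mean $(1 + \sigma + \dots + \sigma^k)/(k + 1)$, which is also $\int_0^1 (\tau + (1 -
  \tau)\sigma)^k\,d\tau$.
\<close>
definition avg_power :: "nat \<Rightarrow> 'a::real_normed_field \<Rightarrow> 'a" where
  "avg_power k \<sigma> = (\<Sum>j\<le>k. \<sigma> ^ j) / of_nat (Suc k)"

lemma norm_avg_power_le:
  assumes "norm \<sigma> \<le> M" "1 \<le> M"
  shows "norm (avg_power k \<sigma>) \<le> M ^ k"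
proof -
  have "norm (\<Sum>j\<le>k. \<sigma> ^ j) \<le> of_nat (card {..k}) * M ^ k"
  proof (rule sum_norm_bound)
    fix j assume "j \<in> {..k}"
    have "norm (\<sigma> ^ j) \<le> M ^ j" using assms by (simp add: norm_power power_mono)
    also have "\<dots> \<le> M ^ k" using \<open>j \<in> {..k}\<close> assms by (intro power_increasing) auto
    finally show "norm (\<sigma> ^ j) \<le> M ^ k" .
  qed
  then have "norm (\<Sum>j\<le>k. \<sigma> ^ j) \<le> real (Suc k) * M ^ k" by simp
  moreover have "norm (avg_power k \<sigma>) = norm (\<Sum>j\<le>k. \<sigma> ^ j) / real (Suc k)"
    unfolding avg_power_def norm_divide norm_of_nat ..
  ultimately show ?thesis by (simp add: divide_le_eq mult.commute del: of_nat_Suc)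
qed

lemma avg_power_geometric: "(1 - \<sigma>) * avg_power k \<sigma> = (1 - \<sigma> ^ Suc k) / of_nat (Suc k)"
  unfolding avg_power_def times_divide_eq_right
  by (simp add: one_diff_power_eq[of _ "Suc k"] lessThan_Suc_atMost del: of_nat_Suc power_Suc)

text \<open>
  For $\psi(y) = \sum_k b_k y^k$ with primitive $G$, this is $(G(s) - G(s\sigma))/(s -
  s\sigma)$, the slope of a secant of $G$. The series defines it also at $\sigma = 1$ and at $s
  = 0$. It is used both over the reals (for the choice of the amplitude) and over the complex
  numbers.
\<close>
definition secant_series :: "(nat \<Rightarrow> real) \<Rightarrow> 'a::{real_normed_field,banach} \<Rightarrow> 'a \<Rightarrow> 'a" where
  "secant_series b s \<sigma> = (\<Sum>k. of_real (b k) * s ^ k * avg_power k \<sigma>)"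

text \<open>
  Convergence data: the coefficients \<open>b\<close> are absolutely summable at radius
  \<open>R\<close>, so that the secant series converges uniformly where \<open>norm \<sigma>
  \<le> M\<close> and \<open>norm s * M \<le> R\<close>.
\<close>
locale small_series =
  fixes b :: "nat \<Rightarrow> real" and R M :: real
  assumes R: "R > 0" and M: "M \<ge> 1"
    and summable: "summable (\<lambda>k. \<bar>b k\<bar> * R ^ k)"
begin

lemma norm_term_le:
  fixes s \<sigma> :: "'a::real_normed_field"
  assumes "norm s * M \<le> R" "norm \<sigma> \<le> M"
  shows "norm (of_real (b k) * s ^ k * avg_power k \<sigma>) \<le> \<bar>b k\<bar> * R ^ k"
proof -
  have "norm (of_real (b k) * s ^ k * avg_power k \<sigma>) = \<bar>b k\<bar> * (norm s ^ k * norm (avg_power k \<sigma>))"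
    by (simp add: norm_mult norm_power)
  also have "\<dots> \<le> \<bar>b k\<bar> * (norm s ^ k * M ^ k)"
    using norm_avg_power_le[OF assms(2) M] by (intro mult_left_mono) auto
  also have "\<dots> = \<bar>b k\<bar> * (norm s * M) ^ k" by (simp add: power_mult_distrib)
  also have "\<dots> \<le> \<bar>b k\<bar> * R ^ k" using assms M by (intro mult_left_mono power_mono) auto
  finally show ?thesis .
qed

lemma summable_term:
  fixes s \<sigma> :: "'a::{real_normed_field,banach}"
  assumes "norm s * M \<le> R" "norm \<sigma> \<le> M"
  shows "summable (\<lambda>k. of_real (b k) * s ^ k * avg_power k \<sigma>)"
  by (rule summable_comparison_test'[OF summable norm_term_le[OF assms]])

lemma continuous_secant_series:
  "continuous_on ({s. \<bar>s\<bar> * M \<le> R} \<times> {\<sigma>::real. \<bar>\<sigma>\<bar> \<le> M}) (\<lambda>p. secant_series b (fst p) (snd p))"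
proof -
  let ?S = "{s. \<bar>s\<bar> * M \<le> R} \<times> {\<sigma>::real. \<bar>\<sigma>\<bar> \<le> M}"
  have "uniform_limit ?S (\<lambda>n p. \<Sum>k<n. of_real (b k) * fst p ^ k * avg_power k (snd p))
      (\<lambda>p. secant_series b (fst p) (snd p)) sequentially"
    unfolding secant_series_def
    by (rule Weierstrass_m_test[OF norm_term_le summable]) auto
  then show ?thesis
    by (rule uniform_limit_theorem[rotated]) (auto simp: avg_power_def intro!: always_eventually continuous_intros simp del: of_nat_Suc)
qed

lemma secant_series_of_real:
  assumes "\<bar>s\<bar> * M \<le> R" "\<bar>\<sigma>\<bar> \<le> M"
  shows "secant_series b (of_real s :: 'a::{real_normed_field,banach}) (of_real \<sigma>) = of_real (secant_series b s \<sigma>)"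
proof -
  have "(\<lambda>k. of_real (b k * s ^ k * avg_power k \<sigma>) :: 'a) sums of_real (secant_series b s \<sigma>)"
    using summable_sums[OF summable_term[of s \<sigma>]] assms
    by (intro sums_of_real) (simp add: secant_series_def)
  moreover have "(of_real (avg_power k \<sigma>) :: 'a) = avg_power k (of_real \<sigma>)" for k
    by (simp add: avg_power_def del: of_nat_Suc)
  ultimately show ?thesis by (simp add: secant_series_def[of b "of_real s :: 'a"] sums_iff)
qed

lemma secant_series_approx:
  fixes s \<sigma> :: "'a::{real_normed_field,banach}"
  assumes "b 0 = 0" "norm s * M \<le> R" "norm \<sigma> \<le> M"
  shows "norm (secant_series b s \<sigma> - of_real (b 1) * s * ((1 + \<sigma>) / 2)) \<le> (M / R)\<^sup>2 * (\<Sum>k. \<bar>b k\<bar> * R ^ k) * (norm s)\<^sup>2"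
proof -
  let ?t = "\<lambda>k. of_real (b k) * s ^ k * avg_power k \<sigma>"
  have "secant_series b s \<sigma> = (\<Sum>k. ?t (k + 2)) + (\<Sum>k<2. ?t k)"
    unfolding secant_series_def by (rule suminf_split_initial_segment[OF summable_term[OF assms(2,3)]])
  also have "(\<Sum>k<2. ?t k) = of_real (b 1) * s * ((1 + \<sigma>) / 2)"
    by (simp add: numeral_2_eq_2 assms(1) avg_power_def)
  finally have E: "secant_series b s \<sigma> - of_real (b 1) * s * ((1 + \<sigma>) / 2) = (\<Sum>k. ?t (k + 2))" by simp
  have le: "norm (?t (k + 2)) \<le> (M / R)\<^sup>2 * (norm s)\<^sup>2 * (\<bar>b (k + 2)\<bar> * R ^ (k + 2))" for k
  proof -
    have "norm (?t (k + 2)) = \<bar>b (k + 2)\<bar> * (norm s ^ (k + 2) * norm (avg_power (k + 2) \<sigma>))"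
      by (simp add: norm_mult norm_power)
    also have "\<dots> \<le> \<bar>b (k + 2)\<bar> * (norm s ^ (k + 2) * M ^ (k + 2))"
      by (intro mult_left_mono norm_avg_power_le[OF assms(3) M]) auto
    also have "\<dots> = \<bar>b (k + 2)\<bar> * ((norm s * M) ^ k * (norm s * M)\<^sup>2)" by (simp add: power_mult_distrib power_add power2_eq_square)
    also have "\<dots> \<le> \<bar>b (k + 2)\<bar> * (R ^ k * (norm s * M)\<^sup>2)"
      using assms M by (intro mult_left_mono mult_right_mono power_mono) auto
    also have "\<dots> = (M / R)\<^sup>2 * (norm s)\<^sup>2 * (\<bar>b (k + 2)\<bar> * R ^ (k + 2))"
      using R by (simp add: field_simps power_add power2_eq_square)
    finally show ?thesis .
  qed
  have sm: "summable (\<lambda>k. \<bar>b (k + 2)\<bar> * R ^ (k + 2))"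
    using summable_ignore_initial_segment[OF summable, of 2] .
  have "norm (\<Sum>k. ?t (k + 2)) \<le> (\<Sum>k. (M / R)\<^sup>2 * (norm s)\<^sup>2 * (\<bar>b (k + 2)\<bar> * R ^ (k + 2)))"
    by (rule norm_suminf_le[OF le summable_mult[OF sm]])
  also have "\<dots> = (M / R)\<^sup>2 * (norm s)\<^sup>2 * (\<Sum>k. \<bar>b (k + 2)\<bar> * R ^ (k + 2))"
    by (rule suminf_mult[OF sm])
  also have "\<dots> \<le> (M / R)\<^sup>2 * (norm s)\<^sup>2 * (\<Sum>k. \<bar>b k\<bar> * R ^ k)"
  proof (rule mult_left_mono)
    show "(\<Sum>k. \<bar>b (k + 2)\<bar> * R ^ (k + 2)) \<le> (\<Sum>k. \<bar>b k\<bar> * R ^ k)"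
      unfolding suminf_split_initial_segment[OF summable, of 2] using R by (simp add: sum_nonneg)
  qed simp
  finally show ?thesis unfolding E by (simp add: mult_ac)
qed

lemma secant_series_holomorphic:
  fixes s :: complex
  assumes "norm s * M \<le> R"
  shows "secant_series b s holomorphic_on ball 0 M"
proof (rule holomorphic_uniform_sequence[OF open_ball])
  show "(\<lambda>\<sigma>. \<Sum>k<n. of_real (b k) * s ^ k * avg_power k \<sigma>) holomorphic_on ball 0 M" for n
    by (auto simp: avg_power_def simp del: of_nat_Suc intro!: holomorphic_intros)
  fix x :: complex assume "x \<in> ball 0 M"
  then obtain d where d: "d > 0" "cball x d \<subseteq> ball 0 M" by (meson open_contains_cball open_ball)
  have "uniform_limit (cball x d) (\<lambda>n \<sigma>. \<Sum>k<n. of_real (b k) * s ^ k * avg_power k \<sigma>) (secant_series b s) sequentially"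
    unfolding secant_series_def
    by (rule Weierstrass_m_test[OF norm_term_le summable]) (use d assms in \<open>auto simp: subset_iff dist_norm\<close>)
  with d show "\<exists>d. 0 < d \<and> cball x d \<subseteq> ball 0 M \<and>
      uniform_limit (cball x d) (\<lambda>n \<sigma>. \<Sum>k<n. of_real (b k) * s ^ k * avg_power k \<sigma>) (secant_series b s) sequentially"
    by blast
qed

text \<open>
  Differentiation of $(1 - \sigma) s\, h_s(\sigma) = G(s) - G(s\sigma)$ in
  \<open>\<sigma>\<close>, after division by \<open>s\<close>; it holds for $s = 0$ as well
  because the argument works with the divided series.
\<close>
lemma secant_series_ode:
  fixes s \<sigma> :: complex
  assumes s: "norm s * M \<le> R" and \<sigma>: "norm \<sigma> < M"
  shows "secant_series b s \<sigma> - (1 - \<sigma>) * deriv (secant_series b s) \<sigma> = (\<Sum>k. of_real (b k) * (s * \<sigma>) ^ k)"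
proof -
  define c where "c n = (case n of 0 \<Rightarrow> 0 | Suc k \<Rightarrow> of_real (b k) * s ^ k / of_nat (Suc k))" for n
  have cS: "norm (c (Suc k) * x ^ Suc k) \<le> M * (\<bar>b k\<bar> * R ^ k)" if "norm x \<le> M" for k x
  proof -
    have "norm (c (Suc k) * x ^ Suc k) = \<bar>b k\<bar> * (norm s ^ k * norm x ^ Suc k) / real (Suc k)"
      unfolding c_def by (simp add: norm_mult norm_divide norm_power del: of_nat_Suc)
    also have "\<dots> \<le> \<bar>b k\<bar> * (norm s ^ k * norm x ^ Suc k) / 1"
      by (intro divide_left_mono) auto
    also have "\<dots> \<le> \<bar>b k\<bar> * (norm s ^ k * M ^ Suc k)"
      using that by (simp only: div_by_1) (intro mult_left_mono power_mono; simp)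
    also have "\<dots> = M * (\<bar>b k\<bar> * (norm s * M) ^ k)" by (simp add: power_mult_distrib)
    also have "\<dots> \<le> M * (\<bar>b k\<bar> * R ^ k)" using s M by (intro mult_left_mono power_mono) auto
    finally show ?thesis .
  qed
  have sumS: "summable (\<lambda>k. c (Suc k) * x ^ Suc k)" if "norm x \<le> M" for x
    by (rule summable_comparison_test'[OF summable_mult[OF summable] cS[OF that]])
  define Q where "Q x = (\<Sum>n. c n * x ^ n)" for x
  define K where "K = (\<Sum>k. c (Suc k))"
  have sum1: "summable (\<lambda>k. c (Suc k))" using sumS[of 1] M by simp
  have H: "(1 - x) * secant_series b s x = K - Q x" if "norm x \<le> M" for x
  proof -
    have "Q x = (\<Sum>k. c (Suc k) * x ^ Suc k)"
      using suminf_split_head[of "\<lambda>n. c n * x ^ n"] sumS[OF that] summable_Suc_iff[of "\<lambda>n. c n * x ^ n"]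
      by (simp add: Q_def c_def)
    then have "K - Q x = (\<Sum>k. c (Suc k) - c (Suc k) * x ^ Suc k)"
      unfolding K_def using suminf_diff[OF sum1 sumS[OF that]] by simp
    also have "\<dots> = (\<Sum>k. (1 - x) * (of_real (b k) * s ^ k * avg_power k x))"
    proof (rule suminf_cong)
      fix k
      have "(1 - x) * (of_real (b k) * s ^ k * avg_power k x) = of_real (b k) * s ^ k * ((1 - x) * avg_power k x)"
        by (simp add: mult_ac)
      also have "\<dots> = c (Suc k) - c (Suc k) * x ^ Suc k"
        unfolding avg_power_geometric by (simp add: c_def field_simps del: of_nat_Suc)
      finally show "c (Suc k) - c (Suc k) * x ^ Suc k = (1 - x) * (of_real (b k) * s ^ k * avg_power k x)" by simp
    qed
    also have "\<dots> = (1 - x) * secant_series b s x"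
      unfolding secant_series_def by (rule suminf_mult[OF summable_term[OF s that]])
    finally show ?thesis by simp
  qed
  have sumM: "summable (\<lambda>n. c n * of_real M ^ n)"
    using sumS[of "of_real M"] M by (simp add: summable_Suc_iff[symmetric, of "\<lambda>n. c n * of_real M ^ n"])
  have dQ: "(Q has_field_derivative (\<Sum>n. diffs c n * \<sigma> ^ n)) (at \<sigma>)"
    unfolding Q_def using termdiffs_strong[OF sumM, of \<sigma>] \<sigma> M by simp
  have "diffs c n * \<sigma> ^ n = of_real (b n) * (s * \<sigma>) ^ n" for n
    by (simp add: diffs_def c_def power_mult_distrib del: of_nat_Suc)
  with dQ have dQ: "(Q has_field_derivative (\<Sum>n. of_real (b n) * (s * \<sigma>) ^ n)) (at \<sigma>)" by simp
  have dH: "(secant_series b s has_field_derivative deriv (secant_series b s) \<sigma>) (at \<sigma>)"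
    using \<sigma> by (intro holomorphic_derivI[OF secant_series_holomorphic[OF s] open_ball]) simp
  have "((\<lambda>x. (1 - x) * secant_series b s x) has_field_derivative
      (1 - \<sigma>) * deriv (secant_series b s) \<sigma> - secant_series b s \<sigma>) (at \<sigma>)"
    by (rule derivative_eq_intros dH refl)+ simp
  moreover have "((\<lambda>x. (1 - x) * secant_series b s x) has_field_derivative
      - (\<Sum>n. of_real (b n) * (s * \<sigma>) ^ n)) (at \<sigma>)"
  proof (rule has_field_derivative_transform_within_open[OF _ open_ball])
    show "((\<lambda>x. K - Q x) has_field_derivative - (\<Sum>n. of_real (b n) * (s * \<sigma>) ^ n)) (at \<sigma>)"
      by (rule derivative_eq_intros dQ refl)+ simp
    show "\<sigma> \<in> ball 0 M" using \<sigma> by simp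
    show "K - Q x = (1 - x) * secant_series b s x" if "x \<in> ball 0 M" for x
      using H[of x] that by simp
  qed
  ultimately have "(1 - \<sigma>) * deriv (secant_series b s) \<sigma> - secant_series b s \<sigma> = - (\<Sum>n. of_real (b n) * (s * \<sigma>) ^ n)"
    by (rule DERIV_unique)
  then show ?thesis by (simp add: algebra_simps)
qed

end

section \<open>Inversion of a periodic perturbation of the identity\<close>

lemma nearby_period_multiple:
  fixes x :: real obtains n :: int where "\<bar>x + 2*pi * of_int n\<bar> \<le> pi"
proof -
  have "\<bar>x / (2*pi) - of_int (round (x / (2*pi)))\<bar> \<le> 1/2"
    by (metis of_int_round_abs_le abs_minus_commute)
  then have "\<bar>x / (2*pi) - of_int (round (x / (2*pi)))\<bar> * (2*pi) \<le> 1/2 * (2*pi)"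
    by (intro mult_right_mono) auto
  then have "\<bar>(x / (2*pi) - of_int (round (x / (2*pi)))) * (2*pi)\<bar> \<le> pi"
    by (simp add: abs_mult)
  then have "\<bar>x + 2*pi * of_int (- round (x / (2*pi)))\<bar> \<le> pi"
    by (simp add: algebra_simps)
  then show ?thesis by (rule that)
qed

text \<open>
  If \<open>P\<close> is even, periodic, real on the real line, close to 1 and of mean 1, then
  its odd primitive is the identity plus a small periodic function. The equation $\Theta' =
  1/P(\Theta)$, $\Theta(0) = 0$, is therefore solved by a function on a smaller strip that is
  odd, commutes with the translation by $2\pi$ and stays close to the identity.
\<close>
lemma perturbed_identity_inverse:
  fixes P :: "complex \<Rightarrow> complex" and \<eta> :: real
  assumes hol: "P holomorphic_on strip 1"
    and per: "\<And>z. z \<in> strip 1 \<Longrightarrow> P (z + of_real (2*pi)) = P z"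
    and even: "\<And>z. z \<in> strip 1 \<Longrightarrow> P (- z) = P z"
    and real: "\<And>x. P (of_real x) \<in> \<real>"
    and near: "\<And>z. z \<in> strip 1 \<Longrightarrow> cmod (P z - 1) \<le> \<eta>" and \<eta>: "\<eta> \<le> 1/20"
    and mean: "integral {0..2*pi} (\<lambda>x. P (of_real x)) = of_real (2*pi)"
  obtains \<Theta> where "\<Theta> holomorphic_on strip (1/2)"
    and "\<And>z. z \<in> strip (1/2) \<Longrightarrow> \<Theta> z \<in> strip 1"
    and "\<And>z. z \<in> strip (1/2) \<Longrightarrow> (\<Theta> has_field_derivative inverse (P (\<Theta> z))) (at z)"
    and "\<And>z. z \<in> strip (1/2) \<Longrightarrow> cmod (\<Theta> z - z) \<le> 5 * \<eta>"
    and "\<And>z. z \<in> strip (1/2) \<Longrightarrow> \<Theta> (- z) = - \<Theta> z"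
    and "\<And>z. z \<in> strip (1/2) \<Longrightarrow> \<Theta> (z + of_real (2*pi)) = \<Theta> z + of_real (2*pi)"
    and "\<And>x. \<Theta> (of_real x) \<in> \<real>"
proof -
  have \<eta>0: "\<eta> \<ge> 0" by (rule order_trans[OF norm_ge_zero near[of 0]]) simp
  obtain G where G: "\<And>z. z \<in> strip 1 \<Longrightarrow> (G has_field_derivative P z) (at z)"
    using holomorphic_strip_primitive[OF hol] by blast
  define Y where "Y z = G z - G 0" for z
  have Y: "(Y has_field_derivative P z) (at z)" if "z \<in> strip 1" for z
    unfolding Y_def by (rule derivative_eq_intros G that refl)+ simp
  have Y0: "Y 0 = 0" by (simp add: Y_def)
  have "((\<lambda>x. P (0 + of_real x)) has_integral (Y (0 + of_real (2*pi)) - Y (0 + of_real 0))) {0..2*pi}"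
    by (intro integral_eq_primitive_increment Y) auto
  then have Y2pi: "Y (of_real (2*pi)) = of_real (2*pi)"
    using mean Y0 by (simp add: integral_unique)
  have Yper: "Y (z + of_real (2*pi)) = Y z + of_real (2*pi)" if "z \<in> strip 1" for z
  proof -
    have "Y (z + of_real (2*pi)) - Y z = Y (0 + of_real (2*pi)) - Y 0"
      by (rule period_increment_of_primitive[of 1 Y P "2*pi"]) (use Y per that in auto)
    then show ?thesis using Y2pi Y0 by (simp add: algebra_simps)
  qed
  have Yodd: "Y (- z) = - Y z" if "z \<in> strip 1" for z
  proof -
    have "((\<lambda>z. Y z + Y (- z)) has_field_derivative 0) (at z within strip 1)" if z: "z \<in> strip 1" for z
    proof -
      have "((\<lambda>z. Y (- z)) has_field_derivative P (- z) * (- 1)) (at z)"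
        by (rule DERIV_chain2[OF Y]) (use z in \<open>auto intro!: derivative_eq_intros\<close>)
      from DERIV_add[OF Y[OF z] this] show ?thesis
        using even[OF z] by (simp add: has_field_derivative_at_within)
    qed
    from has_field_derivative_zero_constant[OF convex_strip this]
    obtain k where k: "\<And>z. z \<in> strip 1 \<Longrightarrow> Y z + Y (- z) = k" by blast
    from k[of 0] k[OF that] show ?thesis using Y0 by (simp add: add_eq_0_iff)
  qed
  have Yreal: "Y (of_real x) \<in> \<real>" for x
  proof -
    have "((\<lambda>x. Im (Y (of_real x))) has_field_derivative 0) (at x within UNIV)" for x
    proof -
      have "((\<lambda>x. Y (of_real x)) has_vector_derivative P (of_real x)) (at x)"
        by (rule has_vector_derivative_real_field) (simp add: Y)
      then have "((\<lambda>x. Im (Y (of_real x))) has_vector_derivative Im (P (of_real x))) (at x)"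
        by (rule bounded_linear.has_vector_derivative[OF bounded_linear_Im])
      moreover have "Im (P (of_real x)) = 0" using real[of x] by (simp add: complex_is_Real_iff)
      ultimately show ?thesis by (simp add: has_real_derivative_iff_has_vector_derivative)
    qed
    from has_field_derivative_zero_constant[OF convex_UNIV this]
    obtain k where k: "\<And>x. Im (Y (of_real x)) = k" by auto
    from k[of 0] k[of x] show ?thesis using Y0 by (simp add: complex_is_Real_iff)
  qed
  define p where "p z = Y z - z" for z
  have p: "(p has_field_derivative P z - 1) (at z)" if "z \<in> strip 1" for z
    unfolding p_def by (rule derivative_eq_intros Y that refl)+
  have lip: "cmod (p z - p w) \<le> \<eta> * cmod (z - w)" if "z \<in> strip 1" "w \<in> strip 1" for z w
    by (rule field_differentiable_bound[OF convex_strip _ near that]) (auto intro!: has_field_derivative_at_within p)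
  interpret p: periodic_on_strip p 1
  proof
    show "p holomorphic_on strip 1" unfolding holomorphic_on_open[OF open_strip] using p by blast
    show "p (z + of_real (2*pi)) = p z" if "z \<in> strip 1" for z
      using Yper[OF that] by (simp add: p_def)
  qed simp
  have pbound: "cmod (p z) \<le> 5 * \<eta>" if z: "z \<in> strip 1" for z
  proof -
    obtain n where n: "\<bar>Re z + 2*pi * of_int n\<bar> \<le> pi" by (rule nearby_period_multiple)
    define z' where "z' = z + of_real (2*pi) * of_int n"
    have z': "z' \<in> strip 1" using z by (simp add: z'_def)
    have "cmod z' \<le> \<bar>Re z'\<bar> + \<bar>Im z'\<bar>" by (rule cmod_le)
    also have "\<dots> \<le> pi + 1" using n z by (simp add: z'_def)
    finally have "cmod z' \<le> 5" using pi_less_4 by simp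
    have "p z = p z' - p 0" using p.per_int[OF z, of n] by (simp add: z'_def p_def Y0)
    then have "cmod (p z) \<le> \<eta> * cmod z'" using lip[OF z', of 0] by simp
    also have "\<dots> \<le> \<eta> * 5" using \<open>cmod z' \<le> 5\<close> \<eta>0 by (intro mult_left_mono) auto
    finally show ?thesis by simp
  qed
  have inj: "inj_on Y (strip 1)"
  proof (rule inj_onI)
    fix z w assume zw: "z \<in> strip 1" "w \<in> strip 1" "Y z = Y w"
    then have "cmod (z - w) = cmod (p z - p w)" by (simp add: p_def norm_minus_commute)
    also have "\<dots> \<le> \<eta> * cmod (z - w)" by (rule lip[OF zw(1,2)])
    also have "\<dots> \<le> 1/20 * cmod (z - w)" using \<eta> by (intro mult_right_mono) auto
    finally show "z = w" by simp
  qed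
  have surj: "\<exists>\<theta>\<in>strip 1. Y \<theta> = z" if z: "z \<in> strip (1/2)" for z
  proof -
    have sub: "\<theta> \<in> strip 1" if "\<theta> \<in> cball z (1/4)" for \<theta>
    proof -
      have "\<bar>Im (z - \<theta>)\<bar> \<le> 1/4" using that abs_Im_le_cmod[of "z - \<theta>"] by (simp add: dist_norm)
      then show ?thesis using z by (simp only: strip_iff minus_complex.simps)
    qed
    \<comment> \<open>$Y(\theta) = z$ is the fixed point equation $\theta = z - p(\theta)$ for a contraction.\<close>
    have "\<exists>!\<theta>\<in>cball z (1/4). z - p \<theta> = \<theta>"
    proof (rule Banach_fix[of _ "1/20"])
      show "(\<lambda>\<theta>. z - p \<theta>) ` cball z (1/4) \<subseteq> cball z (1/4)"
        using pbound[OF sub] \<eta> by (force simp: dist_norm)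
      show "dist (z - p x) (z - p y) \<le> 1/20 * dist x y" if "x \<in> cball z (1/4)" "y \<in> cball z (1/4)" for x y
      proof -
        have "dist (z - p x) (z - p y) = cmod (p x - p y)" by (simp add: dist_norm norm_minus_commute)
        also have "\<dots> \<le> \<eta> * cmod (x - y)" using that by (intro lip sub)
        also have "\<dots> \<le> 1/20 * dist x y" using \<eta> unfolding dist_norm by (intro mult_right_mono) auto
        finally show ?thesis .
      qed
    qed (auto simp: complete_eq_closed)
    then obtain \<theta> where "\<theta> \<in> cball z (1/4)" "z - p \<theta> = \<theta>" by blast
    then show ?thesis using sub by (auto simp: p_def)
  qed
  have holY: "Y holomorphic_on strip 1" unfolding holomorphic_on_open[OF open_strip] using Y by blast
  obtain \<Theta> where \<Theta>: "\<Theta> holomorphic_on (Y ` strip 1)"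
      "\<And>z. z \<in> strip 1 \<Longrightarrow> deriv Y z * deriv \<Theta> (Y z) = 1" "\<And>z. z \<in> strip 1 \<Longrightarrow> \<Theta> (Y z) = z"
    using holomorphic_has_inverse[OF holY open_strip inj] by metis
  have sub: "strip (1/2) \<subseteq> Y ` strip 1" using surj by blast
  have h: "\<Theta> holomorphic_on strip (1/2)" by (rule holomorphic_on_subset[OF \<Theta>(1) sub])
  have \<Theta>1: "\<Theta> z \<in> strip 1" "Y (\<Theta> z) = z" if "z \<in> strip (1/2)" for z
    using surj[OF that] \<Theta>(3) by auto
  show ?thesis
  proof (rule that)
    fix z assume z: "z \<in> strip (1/2)"
    have "deriv Y (\<Theta> z) = P (\<Theta> z)" using Y[OF \<Theta>1(1)[OF z]] by (rule DERIV_imp_deriv)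
    then have "P (\<Theta> z) * deriv \<Theta> z = 1" using \<Theta>(2)[OF \<Theta>1(1)[OF z]] \<Theta>1(2)[OF z] by simp
    then have "deriv \<Theta> z = inverse (P (\<Theta> z))" by (metis inverse_unique)
    then show "(\<Theta> has_field_derivative inverse (P (\<Theta> z))) (at z)"
      using holomorphic_derivI[OF h open_strip z] by simp
    show "cmod (\<Theta> z - z) \<le> 5 * \<eta>"
      using pbound[OF \<Theta>1(1)[OF z]] \<Theta>1(2)[OF z] by (simp add: p_def norm_minus_commute)
    show "\<Theta> (- z) = - \<Theta> z"
      using \<Theta>(3)[of "- \<Theta> z"] Yodd[OF \<Theta>1(1)[OF z]] \<Theta>1[OF z] by simp
    show "\<Theta> (z + of_real (2*pi)) = \<Theta> z + of_real (2*pi)"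
      using \<Theta>(3)[of "\<Theta> z + of_real (2*pi)"] Yper[OF \<Theta>1(1)[OF z]] \<Theta>1[OF z] by simp
  next
    fix x :: real
    have near_x: "\<bar>Re (Y (of_real t)) - t\<bar> \<le> 1" for t
    proof -
      have "\<bar>Re (p (of_real t))\<bar> \<le> cmod (p (of_real t))" by (rule abs_Re_le_cmod)
      also have "\<dots> \<le> 1" using pbound[of "of_real t"] \<eta> by simp
      finally show ?thesis by (simp add: p_def)
    qed
    have "continuous_on {x-1..x+1} (\<lambda>t. Re (Y (of_real t)))"
      by (intro continuous_intros continuous_on_compose2[OF holomorphic_on_imp_continuous_on[OF holY]]) auto
    then obtain t where "Re (Y (of_real t)) = x"
      using IVT'[of "\<lambda>t. Re (Y (of_real t))" "x - 1" x "x + 1"] near_x[of "x-1"] near_x[of "x+1"] by force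
    then have "Y (of_real t) = of_real x" using Yreal[of t] by (auto simp: complex_is_Real_iff complex_eq_iff)
    then have "\<Theta> (of_real x) = of_real t" using \<Theta>(3)[of "of_real t"] by simp
    then show "\<Theta> (of_real x) \<in> \<real>" by simp
  qed (use h \<Theta>1 in auto)
qed

section \<open>Choice of the amplitude\<close>

lemma inverse_sqrt_approx:
  fixes x :: real assumes "\<bar>x\<bar> \<le> 1/2"
  shows "\<bar>1 / sqrt (1 + x) - (1 - x / 2)\<bar> \<le> x\<^sup>2"
proof -
  define y where "y = sqrt (1 + x)"
  have y2: "y\<^sup>2 = 1 + x" using assms by (simp add: y_def)
  have "(7/10)\<^sup>2 \<le> y\<^sup>2" using assms unfolding y2 by (simp add: power2_eq_square)
  moreover have "y \<ge> 0" using assms by (simp add: y_def)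
  ultimately have y: "y \<ge> 7/10" by (rule power2_le_imp_le)
  have x: "x = y\<^sup>2 - 1" using y2 by simp
  have eq: "1 / y - (1 - x / 2) = (y - 1)\<^sup>2 * ((y + 2) / (2 * y))"
    using y unfolding x by (simp add: field_simps power2_eq_square)
  have "y + 2 \<le> (y + 1)\<^sup>2 * (2 * y)"
  proof -
    have "7/10 * y \<le> y * y" using y by (intro mult_right_mono) auto
    moreover have "(y + 1)\<^sup>2 * (2 * (7/10)) = 7/5 * (y * y) + 14/5 * y + 7/5"
      by (simp add: power2_eq_square algebra_simps)
    ultimately have "y + 2 \<le> (y + 1)\<^sup>2 * (2 * (7/10))" using y by linarith
    also have "\<dots> \<le> (y + 1)\<^sup>2 * (2 * y)" using y by (intro mult_left_mono) auto
    finally show ?thesis .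
  qed
  then have "(y + 2) / (2 * y) \<le> (y + 1)\<^sup>2" using y by (simp add: divide_le_eq)
  then have "(y - 1)\<^sup>2 * ((y + 2) / (2 * y)) \<le> (y - 1)\<^sup>2 * (y + 1)\<^sup>2" by (intro mult_left_mono) auto
  also have "\<dots> = x\<^sup>2" unfolding x by (simp add: power2_eq_square algebra_simps)
  finally have "1 / y - (1 - x / 2) \<le> x\<^sup>2" unfolding eq .
  moreover have "0 \<le> 1 / y - (1 - x / 2)" unfolding eq using y by simp
  ultimately show ?thesis by (simp add: y_def)
qed

lemma inverse_csqrt_near_1:
  fixes x :: complex assumes "cmod x \<le> 1/2"
  shows "cmod (1 / csqrt (1 + x) - 1) \<le> 2 * cmod x"
proof -
  define q where "q = csqrt (1 + x)"
  have q2: "q\<^sup>2 = 1 + x" by (simp add: q_def)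
  have "Re q \<ge> 0" unfolding q_def using csqrt_principal[of "1 + x"] by auto
  then have "1 \<le> Re (q + 1)" by simp
  then have q1: "1 \<le> cmod (q + 1)" using complex_Re_le_cmod order_trans by blast
  have "1 - cmod x \<le> cmod (1 + x)" by (metis norm_diff_ineq norm_one)
  then have "(1/2)\<^sup>2 \<le> (cmod q)\<^sup>2" using assms by (simp add: q2 norm_power[symmetric] power2_eq_square[of "1/2::real"])
  then have qh: "1/2 \<le> cmod q" by (rule power2_le_imp_le) simp
  then have "q \<noteq> 0" by auto
  have "(q - 1) * (q + 1) = x" using q2 by (simp add: algebra_simps power2_eq_square)
  then have "cmod (q - 1) * cmod (q + 1) = cmod x" by (metis norm_mult)
  moreover have "cmod (q - 1) * 1 \<le> cmod (q - 1) * cmod (q + 1)" using q1 by (intro mult_left_mono) auto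
  ultimately have "cmod (q - 1) \<le> cmod x" by simp
  have "1 / q - 1 = (1 - q) / q" using \<open>q \<noteq> 0\<close> by (simp add: field_simps)
  then have "cmod (1 / q - 1) = cmod (q - 1) / cmod q" by (simp add: norm_divide norm_minus_commute)
  also have "\<dots> \<le> cmod x / (1/2)" using \<open>cmod (q - 1) \<le> cmod x\<close> qh by (intro frac_le) auto
  finally show ?thesis by (simp add: q_def)
qed

lemma integral_half_one_plus_sin_squared:
  "((\<lambda>x::real. (1 + (sin x)\<^sup>2) / 2) has_integral (2 * pi * (3/4))) {0..2*pi}"
proof -
  have "((\<lambda>x::real. (1 + (sin x)\<^sup>2) / 2) has_integral
      ((3 * (2*pi) / 4 - sin (2*pi) * cos (2*pi) / 4) - (3 * 0 / 4 - sin 0 * cos 0 / 4))) {0..2*pi}"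
  proof (rule fundamental_theorem_of_calculus)
    fix x :: real
    have "((\<lambda>x. 3 * x / 4 - sin x * cos x / 4) has_real_derivative (3 / 4 - (cos x * cos x - sin x * sin x) / 4)) (at x)"
      by (auto intro!: derivative_eq_intros)
    moreover have "3 / 4 - (cos x * cos x - sin x * sin x) / 4 = (1 + (sin x)\<^sup>2) / 2"
    proof -
      have "cos x * cos x = 1 - (sin x)\<^sup>2" by (simp add: power2_eq_square[symmetric] cos_squared_eq)
      then show ?thesis unfolding power2_eq_square by (simp add: diff_divide_distrib add_divide_distrib)
    qed
    ultimately show "((\<lambda>x. 3 * x / 4 - sin x * cos x / 4) has_vector_derivative (1 + (sin x)\<^sup>2) / 2) (at x within {0..2*pi})"
      by (simp add: has_real_derivative_iff_has_vector_derivative[symmetric] has_field_derivative_at_within)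
  qed simp
  then show ?thesis by simp
qed

text \<open>
  The rescaled nonlinearity $\psi(y) = \sum_k b_k y^k$ with $\psi(0) = 0$ and $\psi'(0) = \beta
  > 0$. The bound 9 on \<open>\<sigma> = (sin \<theta>)\<^sup>2\<close> is sufficient on the
  strip of half-width 1, where \<open>cmod (sin \<theta>) < 3\<close>.
\<close>
locale nls_series = small_series b R 9 for b R +
  fixes \<beta> :: real
  assumes b0: "b 0 = 0" and b1: "b 1 = \<beta>" and \<beta>: "\<beta> > 0"
begin

text \<open>
  The constant in the quadratic remainder of the secant series as a function of
  \<open>s\<close>.
\<close>
definition remainder_const :: real where
  "remainder_const = (9 / R)\<^sup>2 * (\<Sum>k. \<bar>b k\<bar> * R ^ k)"

lemma remainder_const_nonneg: "remainder_const \<ge> 0"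
  unfolding remainder_const_def using R by (intro mult_nonneg_nonneg suminf_nonneg summable) auto

text \<open>
  The reciprocal of the angular speed $\Theta'$ at the angle \<open>x\<close>, for squared
  amplitude \<open>s\<close>. Its integral over $[0, 2\pi]$ is the period of $f$.
\<close>
definition travel_time :: "real \<Rightarrow> real \<Rightarrow> real \<Rightarrow> real" where
  "travel_time \<epsilon> s x = 1 / sqrt (1 + (\<epsilon> - secant_series b s ((sin x)\<^sup>2)))"

lemma real_argument_bound:
  assumes s: "0 \<le> s" "s * 9 \<le> R" and \<sigma>: "0 \<le> \<sigma>" "\<sigma> \<le> 1"
  shows "\<bar>secant_series b s \<sigma> - \<beta> * s * ((1 + \<sigma>) / 2)\<bar> \<le> remainder_const * s\<^sup>2"
    and "\<bar>secant_series b s \<sigma>\<bar> \<le> \<beta> * s + remainder_const * s\<^sup>2"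
proof -
  show 1: "\<bar>secant_series b s \<sigma> - \<beta> * s * ((1 + \<sigma>) / 2)\<bar> \<le> remainder_const * s\<^sup>2"
    using secant_series_approx[of s \<sigma>] b0 b1 assms by (simp add: remainder_const_def)
  have "\<beta> * s * ((1 + \<sigma>) / 2) \<le> \<beta> * s * 1" using \<beta> assms by (intro mult_left_mono) auto
  moreover have "0 \<le> \<beta> * s * ((1 + \<sigma>) / 2)" using \<beta> assms by simp
  ultimately show "\<bar>secant_series b s \<sigma>\<bar> \<le> \<beta> * s + remainder_const * s\<^sup>2" using 1 by linarith
qed

text \<open>
  The error of the expansion of the period, relative to $2\pi$, is at most this constant times
  $\varepsilon^2$ in the range of \<open>s\<close> below.
\<close>
definition period_const :: real where
  "period_const = 25 + 32 * remainder_const / (9 * \<beta>\<^sup>2)"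

text \<open>
  Smallness of the detuning \<open>\<epsilon>\<close>. Squared amplitudes are sought below
  $8\varepsilon/(3\beta)$, twice their first order value; the third and fourth conditions give
  convergence and a small quadratic remainder on the range $0 \le s \le 8\varepsilon/(3\beta)$,
  and the last one keeps the interval for the intermediate value theorem inside that range. The
  bound 1/640 keeps the complex integrand within 1/20 of 1.
\<close>
definition small_param :: "real \<Rightarrow> bool" where
  "small_param \<epsilon> \<longleftrightarrow> 0 < \<epsilon> \<and> \<epsilon> \<le> 1/640 \<and> 8 * \<epsilon> / (3 * \<beta>) * 9 \<le> R
      \<and> remainder_const * (8 * \<epsilon> / (3 * \<beta>))\<^sup>2 \<le> \<epsilon> \<and> 8 * period_const * \<epsilon> \<le> 1"

lemma period_const_pos: "period_const > 0"
  unfolding period_const_def using remainder_const_nonneg \<beta> by (intro add_pos_nonneg divide_nonneg_pos) auto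

lemma small_param_ex: "\<exists>\<epsilon>1>0. \<forall>\<epsilon>. 0 < \<epsilon> \<and> \<epsilon> \<le> \<epsilon>1 \<longrightarrow> small_param \<epsilon>"
proof -
  let ?c = "remainder_const * (8 / (3 * \<beta>))\<^sup>2"
  have c: "?c \<ge> 0" using remainder_const_nonneg by simp
  define \<epsilon>1 where "\<epsilon>1 = Min {1/640, R * (3 * \<beta>) / 72, 1 / (?c + 1), 1 / (8 * period_const)}"
  have "\<epsilon>1 > 0" using R \<beta> c period_const_pos by (simp add: \<epsilon>1_def add_nonneg_pos)
  moreover have "small_param \<epsilon>" if "0 < \<epsilon>" "\<epsilon> \<le> \<epsilon>1" for \<epsilon>
  proof -
    have l: "\<epsilon> \<le> 1/640" "\<epsilon> \<le> R * (3 * \<beta>) / 72" "\<epsilon> \<le> 1 / (?c + 1)" "\<epsilon> \<le> 1 / (8 * period_const)"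
      using that by (simp_all add: \<epsilon>1_def)
    have "\<epsilon> * (?c + 1) \<le> 1" using l(3) c by (simp add: le_divide_eq)
    then have "\<epsilon> * ?c \<le> 1" using that by (simp add: ring_distribs)
    then have "(\<epsilon> * ?c) * \<epsilon> \<le> 1 * \<epsilon>" using that by (intro mult_right_mono) auto
    moreover have "remainder_const * (8 * \<epsilon> / (3 * \<beta>))\<^sup>2 = (\<epsilon> * ?c) * \<epsilon>"
      by (simp add: power2_eq_square)
    ultimately have "remainder_const * (8 * \<epsilon> / (3 * \<beta>))\<^sup>2 \<le> \<epsilon>" by linarith
    moreover have "8 * period_const * \<epsilon> \<le> 1" using l(4) period_const_pos by (simp add: le_divide_eq mult_ac)
    moreover have "8 * \<epsilon> / (3 * \<beta>) * 9 \<le> R" using l(2) \<beta> by (simp add: field_simps)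
    ultimately show ?thesis using that l(1) by (simp add: small_param_def)
  qed
  ultimately show ?thesis by blast
qed


lemma sqrt_argument_bound:
  assumes \<epsilon>: "small_param \<epsilon>" and s: "0 \<le> s" "s \<le> 8 * \<epsilon> / (3 * \<beta>)"
  shows "s * 9 \<le> R" and "remainder_const * s\<^sup>2 \<le> \<epsilon>"
    and "\<bar>\<epsilon> - secant_series b s ((sin x)\<^sup>2)\<bar> \<le> 5 * \<epsilon>"
proof -
  have "s * 9 \<le> 8 * \<epsilon> / (3 * \<beta>) * 9" using s by (intro mult_right_mono) auto
  also have "\<dots> \<le> R" using \<epsilon> by (simp add: small_param_def)
  finally show sR: "s * 9 \<le> R" .
  have "remainder_const * s\<^sup>2 \<le> remainder_const * (8 * \<epsilon> / (3 * \<beta>))\<^sup>2"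
    using s remainder_const_nonneg by (intro mult_left_mono power_mono) auto
  also have "\<dots> \<le> \<epsilon>" using \<epsilon> by (simp add: small_param_def)
  finally show rs: "remainder_const * s\<^sup>2 \<le> \<epsilon>" .
  have "\<beta> * s \<le> \<beta> * (8 * \<epsilon> / (3 * \<beta>))" using s \<beta> by (intro mult_left_mono) auto
  then have bs: "\<beta> * s \<le> 8/3 * \<epsilon>" using \<beta> by simp
  have "(sin x)\<^sup>2 \<le> 1" by (simp add: abs_square_le_1)
  then show "\<bar>\<epsilon> - secant_series b s ((sin x)\<^sup>2)\<bar> \<le> 5 * \<epsilon>"
    using real_argument_bound(2)[OF s(1) sR, of "(sin x)\<^sup>2"] rs bs \<epsilon> by (simp add: small_param_def)
qed

lemma travel_time_continuous:
  assumes \<epsilon>: "small_param \<epsilon>"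
  shows "continuous_on ({0..8 * \<epsilon> / (3 * \<beta>)} \<times> UNIV) (\<lambda>p. travel_time \<epsilon> (fst p) (snd p))"
proof -
  let ?U = "{0..8 * \<epsilon> / (3 * \<beta>)} \<times> (UNIV :: real set)"
  have in_dom: "(fst p, (sin (snd p))\<^sup>2) \<in> {s. \<bar>s\<bar> * 9 \<le> R} \<times> {\<sigma>. \<bar>\<sigma>\<bar> \<le> 9}" if "p \<in> ?U" for p
  proof -
    have "(sin (snd p))\<^sup>2 \<le> 1" by (simp add: abs_square_le_1)
    then show ?thesis using that sqrt_argument_bound(1)[OF \<epsilon>, of "fst p"] by auto
  qed
  have "continuous_on ?U (\<lambda>p. secant_series b (fst (fst p, (sin (snd p))\<^sup>2)) (snd (fst p, (sin (snd p))\<^sup>2)))"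
    by (rule continuous_on_compose2[OF continuous_secant_series, where f = "\<lambda>p. (fst p, (sin (snd p))\<^sup>2)"])
      (use in_dom in \<open>auto intro!: continuous_intros\<close>)
  then have "continuous_on ?U (\<lambda>p. secant_series b (fst p) ((sin (snd p))\<^sup>2))" by simp
  moreover have "1 + (\<epsilon> - secant_series b (fst p) ((sin (snd p))\<^sup>2)) > 0" if "p \<in> ?U" for p
    using sqrt_argument_bound(3)[OF \<epsilon>, of "fst p" "snd p"] that \<epsilon> by (auto simp: small_param_def)
  ultimately show ?thesis
    unfolding travel_time_def by (intro continuous_intros) (auto simp: less_imp_neq[symmetric])
qed

text \<open>
  The expansion of the period to first order, with an error quadratic in
  \<open>\<epsilon>\<close>.
\<close>
lemma travel_time_integral_approx:
  assumes \<epsilon>: "small_param \<epsilon>" and s: "0 \<le> s" "s \<le> 8 * \<epsilon> / (3 * \<beta>)"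
  shows "\<bar>integral {0..2*pi} (travel_time \<epsilon> s) - 2 * pi * (1 - \<epsilon> / 2 + 3 * \<beta> * s / 8)\<bar> \<le> 2 * pi * (period_const * \<epsilon>\<^sup>2)"
proof -
  let ?lin = "\<lambda>x. (1 - \<epsilon> / 2) + \<beta> * s / 2 * ((1 + (sin x)\<^sup>2) / 2)"
  note b = sqrt_argument_bound[OF \<epsilon> s]
  have \<epsilon>0: "0 < \<epsilon>" "\<epsilon> \<le> 1/640" using \<epsilon> by (auto simp: small_param_def)
  have pt: "norm (travel_time \<epsilon> s x - ?lin x) \<le> period_const * \<epsilon>\<^sup>2" for x
  proof -
    define y where "y = \<epsilon> - secant_series b s ((sin x)\<^sup>2)"
    have y: "\<bar>y\<bar> \<le> 5 * \<epsilon>" using b(3) by (simp add: y_def)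
    then have 1: "\<bar>1 / sqrt (1 + y) - (1 - y / 2)\<bar> \<le> y\<^sup>2" using \<epsilon>0 by (intro inverse_sqrt_approx) simp
    have 2: "y\<^sup>2 \<le> 25 * \<epsilon>\<^sup>2"
      using power_mono[OF y, of 2] by (simp add: power2_eq_square)
    have "(sin x)\<^sup>2 \<le> 1" by (simp add: abs_square_le_1)
    then have 3: "\<bar>secant_series b s ((sin x)\<^sup>2) - \<beta> * s * ((1 + (sin x)\<^sup>2) / 2)\<bar> \<le> remainder_const * s\<^sup>2"
      by (intro real_argument_bound(1) s b(1)) auto
    have "remainder_const * s\<^sup>2 \<le> remainder_const * (8 * \<epsilon> / (3 * \<beta>))\<^sup>2"
      using s remainder_const_nonneg by (intro mult_left_mono power_mono) auto
    also have "\<dots> = 2 * (32 * remainder_const / (9 * \<beta>\<^sup>2)) * \<epsilon>\<^sup>2" by (simp add: power2_eq_square)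
    finally have 4: "remainder_const * s\<^sup>2 / 2 \<le> 32 * remainder_const / (9 * \<beta>\<^sup>2) * \<epsilon>\<^sup>2" by simp
    have 5: "period_const * \<epsilon>\<^sup>2 = 25 * \<epsilon>\<^sup>2 + 32 * remainder_const / (9 * \<beta>\<^sup>2) * \<epsilon>\<^sup>2"
      by (simp add: period_const_def ring_distribs)
    have 6: "travel_time \<epsilon> s x - ?lin x = (1 / sqrt (1 + y) - (1 - y / 2))
        + (secant_series b s ((sin x)\<^sup>2) - \<beta> * s * ((1 + (sin x)\<^sup>2) / 2)) / 2"
      by (simp add: travel_time_def y_def field_simps)
    have "\<bar>A + B / 2\<bar> \<le> c + c'" if "\<bar>A\<bar> \<le> a" "a \<le> c" "\<bar>B\<bar> \<le> a'" "a' / 2 \<le> c'" for A B a a' c c' :: real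
      using that by linarith
    from this[OF 1 2 3 4] show ?thesis unfolding 5 6 real_norm_def .
  qed
  have "continuous_on {0..2*pi} (\<lambda>x. travel_time \<epsilon> (fst (s, x)) (snd (s, x)))"
    by (rule continuous_on_compose2[OF travel_time_continuous[OF \<epsilon>], where f = "\<lambda>x. (s, x)"])
      (use s in \<open>auto intro!: continuous_intros\<close>)
  then have "(travel_time \<epsilon> s has_integral integral {0..2*pi} (travel_time \<epsilon> s)) {0..2*pi}"
    by (intro integrable_integral integrable_continuous_real) simp
  moreover have "(?lin has_integral ((1 - \<epsilon> / 2) * (2 * pi) + \<beta> * s / 2 * (2 * pi * (3/4)))) {0..2*pi}"
    using has_integral_const_real[of "1 - \<epsilon> / 2" 0 "2*pi"]
    by (intro has_integral_add has_integral_mult_right integral_half_one_plus_sin_squared) (simp add: mult.commute)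
  ultimately have "((\<lambda>x. travel_time \<epsilon> s x - ?lin x) has_integral
      integral {0..2*pi} (travel_time \<epsilon> s) - ((1 - \<epsilon> / 2) * (2 * pi) + \<beta> * s / 2 * (2 * pi * (3/4)))) (cbox 0 (2*pi))"
    by (simp add: has_integral_diff)
  from has_integral_bound[OF _ this pt]
  have "\<bar>integral {0..2*pi} (travel_time \<epsilon> s) - ((1 - \<epsilon> / 2) * (2 * pi) + \<beta> * s / 2 * (2 * pi * (3/4)))\<bar>
      \<le> period_const * \<epsilon>\<^sup>2 * (2 * pi)"
    using period_const_pos by simp
  then show ?thesis by (simp add: algebra_simps)
qed

lemma amplitude_exists:
  assumes \<epsilon>: "small_param \<epsilon>"
  obtains s where "0 < s" "s \<le> 8 * \<epsilon> / (3 * \<beta>)"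
    "\<bar>s - 4 * \<epsilon> / (3 * \<beta>)\<bar> \<le> 16 * period_const / (3 * \<beta>) * \<epsilon>\<^sup>2"
    "integral {0..2*pi} (travel_time \<epsilon> s) = 2 * pi"
proof -
  \<comment> \<open>With this parametrisation the first order period is $2\pi(1 + \delta/2)$, and at $\delta = \pm d$ the term $\delta/2$ outweighs the error $d/4$.\<close>
  define S where "S \<delta> = 4 / (3 * \<beta>) * (\<epsilon> + \<delta>)" for \<delta>
  define d where "d = 4 * period_const * \<epsilon>\<^sup>2"
  define T where "T s = integral {0..2*pi} (travel_time \<epsilon> s)" for s
  have \<epsilon>0: "0 < \<epsilon>" "8 * period_const * \<epsilon> \<le> 1" using \<epsilon> by (auto simp: small_param_def)
  have d0: "0 \<le> d" using period_const_pos by (simp add: d_def)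
  have "(8 * period_const * \<epsilon>) * \<epsilon> \<le> 1 * \<epsilon>" using \<epsilon>0 by (intro mult_right_mono) auto
  then have d1: "d \<le> \<epsilon> / 2" by (simp add: d_def power2_eq_square)
  have range: "0 < S \<delta> \<and> S \<delta> \<le> 8 * \<epsilon> / (3 * \<beta>)" if "\<bar>\<delta>\<bar> \<le> d" for \<delta>
  proof -
    have "4 / (3 * \<beta>) * (\<epsilon> + \<delta>) \<le> 4 / (3 * \<beta>) * (2 * \<epsilon>)"
      using that d1 \<epsilon>0 \<beta> by (intro mult_left_mono) auto
    moreover have "0 < 4 / (3 * \<beta>) * (\<epsilon> + \<delta>)" using that d1 \<epsilon>0 \<beta> by simp
    ultimately show ?thesis by (simp add: S_def)
  qed
  have T_approx: "\<bar>T (S \<delta>) - 2 * pi * (1 + \<delta> / 2)\<bar> \<le> 2 * pi * (d / 4)" if "\<bar>\<delta>\<bar> \<le> d" for \<delta>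
  proof -
    have eq: "1 - \<epsilon> / 2 + 3 * \<beta> * S \<delta> / 8 = 1 + \<delta> / 2" using \<beta> by (simp add: S_def field_simps)
    have d: "d / 4 = period_const * \<epsilon>\<^sup>2" by (simp add: d_def)
    show ?thesis
      using travel_time_integral_approx[OF \<epsilon>, of "S \<delta>"] range[OF that] unfolding eq d T_def by simp
  qed
  have "T (S (- d)) \<le> 2 * pi"
  proof -
    have "2 * pi * (1 + - d / 2) + 2 * pi * (d / 4) \<le> 2 * pi" using d0 by (simp add: algebra_simps)
    then show ?thesis using T_approx[of "- d"] d0 by linarith
  qed
  moreover have "2 * pi \<le> T (S d)"
  proof -
    have "2 * pi \<le> 2 * pi * (1 + d / 2) - 2 * pi * (d / 4)" using d0 by (simp add: algebra_simps)
    then show ?thesis using T_approx[of d] d0 by linarith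
  qed
  moreover have "continuous_on {S (- d)..S d} T"
  proof -
    have "continuous_on {S (- d)..S d} (\<lambda>s. integral (cbox 0 (2*pi)) (travel_time \<epsilon> s))"
    proof (rule integral_continuous_on_param)
      have "{S (- d)..S d} \<times> cbox 0 (2*pi) \<subseteq> {0..8 * \<epsilon> / (3 * \<beta>)} \<times> UNIV"
        using range[of d] range[of "- d"] d0 by force
      then show "continuous_on ({S (- d)..S d} \<times> cbox 0 (2*pi)) (\<lambda>(s, x). travel_time \<epsilon> s x)"
        unfolding case_prod_beta by (rule continuous_on_subset[OF travel_time_continuous[OF \<epsilon>]])
    qed
    then show ?thesis by (simp add: T_def[abs_def])
  qed
  moreover have "S (- d) \<le> S d" using d0 \<beta> by (simp add: S_def field_simps)
  ultimately obtain s where s: "S (- d) \<le> s" "s \<le> S d" "T s = 2 * pi"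
    using IVT'[of T "S (- d)" "2 * pi" "S d"] by blast
  show ?thesis
  proof (rule that)
    show "0 < s" "s \<le> 8 * \<epsilon> / (3 * \<beta>)" using s range[of d] range[of "- d"] d0 by auto
    have "S d = 4 * \<epsilon> / (3 * \<beta>) + 16 * period_const / (3 * \<beta>) * \<epsilon>\<^sup>2" "S (- d) = 4 * \<epsilon> / (3 * \<beta>) - 16 * period_const / (3 * \<beta>) * \<epsilon>\<^sup>2"
      using \<beta> by (simp_all add: S_def d_def field_simps)
    then show "\<bar>s - 4 * \<epsilon> / (3 * \<beta>)\<bar> \<le> 16 * period_const / (3 * \<beta>) * \<epsilon>\<^sup>2" using s by linarith
    show "integral {0..2*pi} (travel_time \<epsilon> s) = 2 * pi" using s(3) by (simp add: T_def)
  qed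
qed

end

section \<open>The profile of the rotating wave\<close>

lemma norm_sin_cos_strip:
  assumes "z \<in> strip 1"
  shows "cmod (sin z) < 3" "cmod (cos z) < 3"
proof -
  have e: "exp x < 3" if "x < 1" for x :: real using that exp_le by (meson exp_less_mono less_le_trans)
  have 1: "cmod (exp (\<i> * z)) < 3" "cmod (exp (- (\<i> * z))) < 3"
    using assms by (auto intro!: e)
  have "cmod (exp (\<i> * z) - exp (- (\<i> * z))) < 6" using norm_triangle_ineq4[of "exp (\<i> * z)" "exp (- (\<i> * z))"] 1 by linarith
  then show "cmod (sin z) < 3" by (simp add: sin_exp_eq norm_divide norm_mult)
  have "cmod (exp (\<i> * z) + exp (- (\<i> * z))) < 6" using norm_triangle_ineq[of "exp (\<i> * z)" "exp (- (\<i> * z))"] 1 by linarith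
  then show "cmod (cos z) < 3" by (simp add: cos_exp_eq norm_divide)
qed

lemma sin_plus_2pi_complex: "sin (z + of_real (2*pi)) = sin (z :: complex)"
  by (simp only: sin_add sin_of_real cos_of_real sin_two_pi cos_two_pi) simp

lemma sin_lipschitz_strip:
  assumes "z \<in> strip 1" "w \<in> strip 1"
  shows "cmod (sin z - sin w) \<le> 3 * cmod (z - w)"
  by (rule field_differentiable_bound[OF convex_strip _ _ assms, where f' = cos])
     (auto intro!: derivative_eq_intros less_imp_le norm_sin_cos_strip)

context nls_series begin

lemma complex_argument_bound:
  assumes \<epsilon>: "small_param \<epsilon>" and s: "0 \<le> s" "s \<le> 8 * \<epsilon> / (3 * \<beta>)" and \<sigma>: "cmod \<sigma> \<le> 9"
  shows "cmod (of_real \<epsilon> - secant_series b (of_real s) \<sigma>) \<le> 16 * \<epsilon>"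
proof -
  note b = sqrt_argument_bound[OF \<epsilon> s]
  have \<epsilon>0: "0 < \<epsilon>" using \<epsilon> by (simp add: small_param_def)
  have 1: "cmod (secant_series b (of_real s) \<sigma> - of_real \<beta> * of_real s * ((1 + \<sigma>) / 2)) \<le> remainder_const * s\<^sup>2"
    using secant_series_approx[of "of_real s" \<sigma>] b0 b1 b(1) \<sigma> s by (simp add: remainder_const_def)
  have "cmod (1 + \<sigma>) \<le> 10" using norm_triangle_ineq[of 1 \<sigma>] \<sigma> by simp
  then have "cmod ((1 + \<sigma>) / 2) \<le> 5" by (simp add: norm_divide)
  moreover have "\<beta> * s \<le> 8/3 * \<epsilon>"
    using mult_left_mono[OF s(2), of \<beta>] \<beta> by simp
  ultimately have "(\<beta> * s) * cmod ((1 + \<sigma>) / 2) \<le> (8/3 * \<epsilon>) * 5"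
    using \<beta> s \<epsilon>0 by (intro mult_mono[of "\<beta> * s" "8/3 * \<epsilon>"]) auto
  moreover have "cmod (of_real \<beta> * of_real s * ((1 + \<sigma>) / 2)) = (\<beta> * s) * cmod ((1 + \<sigma>) / 2)"
    using \<beta> s by (simp add: norm_mult norm_divide)
  ultimately have 2: "cmod (of_real \<beta> * of_real s * ((1 + \<sigma>) / 2)) \<le> 40/3 * \<epsilon>" by linarith
  have "cmod (of_real \<epsilon> - secant_series b (of_real s) \<sigma>) \<le> cmod (of_real \<epsilon> :: complex) + cmod (secant_series b (of_real s) \<sigma>)"
    by (rule norm_triangle_ineq4)
  also have "cmod (secant_series b (of_real s) \<sigma>) \<le>
      cmod (secant_series b (of_real s) \<sigma> - of_real \<beta> * of_real s * ((1 + \<sigma>) / 2)) + cmod (of_real \<beta> * of_real s * ((1 + \<sigma>) / 2))"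
    by (metis norm_triangle_ineq diff_add_cancel)
  finally have "cmod (of_real \<epsilon> - secant_series b (of_real s) \<sigma>) \<le> \<bar>\<epsilon>\<bar> + (remainder_const * s\<^sup>2 + 40/3 * \<epsilon>)"
    using 1 2 unfolding norm_of_real by linarith
  then show ?thesis using b(2) \<epsilon>0 by linarith
qed

text \<open>
  The constant in the estimate of the profile: the first summand comes from the error of the
  amplitude, the second one from the error of the angle.
\<close>
definition profile_const :: real where
  "profile_const = 3 * (16 * period_const / (3 * \<beta>)) / sqrt (4 / (3 * \<beta>)) + sqrt (4 / (3 * \<beta>)) * 480"

text \<open>
  The profile $f = a \sin\Theta$ solves the stationary equation on a strip, where it is close to
  a sine wave of amplitude $\sqrt{4\varepsilon/(3\beta)}$.
\<close>
lemma profile_exists: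
  assumes \<epsilon>: "small_param \<epsilon>"
  obtains f f' where "f holomorphic_on strip (1/2)"
    and "\<And>z. z \<in> strip (1/2) \<Longrightarrow> (f has_field_derivative f' z) (at z)"
    and "\<And>z. z \<in> strip (1/2) \<Longrightarrow>
      (f' has_field_derivative ((\<Sum>k. of_real (b k) * ((f z)\<^sup>2) ^ k) - of_real (1 + \<epsilon>)) * f z) (at z)"
    and "\<And>z. z \<in> strip (1/2) \<Longrightarrow> f (z + of_real (2*pi)) = f z"
    and "\<And>z. z \<in> strip (1/2) \<Longrightarrow> f (- z) = - f z"
    and "\<And>x. f (of_real x) \<in> \<real>"
    and "\<And>x. (cmod (f (of_real x)))\<^sup>2 \<le> 8 * \<epsilon> / (3 * \<beta>)"
    and "\<And>z. z \<in> strip (1/2) \<Longrightarrow>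
      cmod (f z - of_real (sqrt (4 * \<epsilon> / (3 * \<beta>))) * sin z) \<le> profile_const * \<epsilon> * sqrt \<epsilon>"
proof -
  obtain s where s: "0 < s" "s \<le> 8 * \<epsilon> / (3 * \<beta>)"
    and s_approx: "\<bar>s - 4 * \<epsilon> / (3 * \<beta>)\<bar> \<le> 16 * period_const / (3 * \<beta>) * \<epsilon>\<^sup>2"
    and s_int: "integral {0..2*pi} (travel_time \<epsilon> s) = 2 * pi"
    using amplitude_exists[OF \<epsilon>] by blast
  have s0: "0 \<le> s" using s by simp
  have \<epsilon>0: "0 < \<epsilon>" "\<epsilon> \<le> 1/640" using \<epsilon> by (auto simp: small_param_def)
  have sR: "s * 9 \<le> R" by (rule sqrt_argument_bound(1)[OF \<epsilon> s0 s(2)])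
  then have sR': "cmod (of_real s) * 9 \<le> R" using s by simp
  define H where "H = secant_series b (of_real s :: complex)"
  define w where "w z = 1 + (of_real \<epsilon> - H ((sin z)\<^sup>2))" for z
  define P where "P z = 1 / csqrt (w z)" for z
  have sin9: "cmod ((sin z)\<^sup>2) < 9" if "z \<in> strip 1" for z
  proof -
    have "(cmod (sin z))\<^sup>2 < 3\<^sup>2" using norm_sin_cos_strip(1)[OF that] by (intro power_strict_mono) auto
    then show ?thesis by (simp add: norm_power)
  qed
  have w_near: "cmod (w z - 1) \<le> 16 * \<epsilon>" if "z \<in> strip 1" for z
    using complex_argument_bound[OF \<epsilon> s0 s(2), of "(sin z)\<^sup>2"] sin9[OF that] by (simp add: w_def H_def)
  have w_Re: "0 < Re (w z)" if "z \<in> strip 1" for z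
    using w_near[OF that] \<epsilon>0 abs_Re_le_cmod[of "w z - 1"] by simp
  have w_nn: "w z \<notin> \<real>\<^sub>\<le>\<^sub>0" if "z \<in> strip 1" for z
    using w_Re[OF that] by (auto simp: complex_nonpos_Reals_iff)
  have w_nz: "csqrt (w z) \<noteq> 0" if "z \<in> strip 1" for z
    using w_Re[OF that] by auto
  have dw: "(w has_field_derivative - (deriv H ((sin z)\<^sup>2) * (2 * sin z * cos z))) (at z)" if "z \<in> strip 1" for z
  proof -
    have "(H has_field_derivative deriv H ((sin z)\<^sup>2)) (at ((sin z)\<^sup>2))"
      unfolding H_def using sin9[OF that] by (intro holomorphic_derivI[OF secant_series_holomorphic[OF sR'] open_ball]) simp
    moreover have "((\<lambda>z. (sin z)\<^sup>2) has_field_derivative 2 * sin z * cos z) (at z)"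
      by (auto intro!: derivative_eq_intros)
    ultimately have "((\<lambda>z. H ((sin z)\<^sup>2)) has_field_derivative deriv H ((sin z)\<^sup>2) * (2 * sin z * cos z)) (at z)"
      by (rule DERIV_chain2)
    then show ?thesis unfolding w_def by (auto intro!: derivative_eq_intros)
  qed
  have w_hol: "w holomorphic_on strip 1" unfolding holomorphic_on_open[OF open_strip] using dw by blast
  have w_real: "w (of_real x) = of_real (1 + (\<epsilon> - secant_series b s ((sin x)\<^sup>2)))" for x
  proof -
    have "(sin x)\<^sup>2 \<le> 1" by (simp add: abs_square_le_1)
    then have "H (of_real ((sin x)\<^sup>2)) = of_real (secant_series b s ((sin x)\<^sup>2))"
      unfolding H_def using sR s by (intro secant_series_of_real) auto
    then show ?thesis by (simp add: w_def sin_of_real)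
  qed
  have P_real: "P (of_real x) = of_real (travel_time \<epsilon> s x)" for x
  proof -
    have "1 + (\<epsilon> - secant_series b s ((sin x)\<^sup>2)) \<ge> 0"
      using w_Re[of "of_real x"] unfolding w_real by simp
    then show ?thesis unfolding P_def w_real travel_time_def by (simp only: of_real_sqrt of_real_divide of_real_1)
  qed
  have P_hol: "P holomorphic_on strip 1"
    unfolding P_def using w_hol w_nn w_nz by (intro holomorphic_intros) auto
  have P_per: "P (z + of_real (2*pi)) = P z" for z
    by (simp only: P_def w_def sin_plus_2pi_complex)
  have P_even: "P (- z) = P z" for z
    by (simp add: P_def w_def)
  have P_near: "cmod (P z - 1) \<le> 32 * \<epsilon>" if "z \<in> strip 1" for z
    using inverse_csqrt_near_1[of "w z - 1"] w_near[OF that] \<epsilon>0 by (simp add: P_def)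
  have P_mean: "integral {0..2*pi} (\<lambda>x. P (of_real x)) = of_real (2*pi)"
  proof -
    have "travel_time \<epsilon> s integrable_on {0..2*pi}"
      using s_int not_integrable_integral by fastforce
    then have "(travel_time \<epsilon> s has_integral 2*pi) {0..2*pi}" using s_int by (metis integrable_integral)
    from has_integral_linear[OF this bounded_linear_of_real]
    show ?thesis unfolding P_real o_def by (rule integral_unique)
  qed
  have small: "32 * \<epsilon> \<le> 1/20" using \<epsilon>0 by simp
  obtain \<Theta> where \<Theta>_hol: "\<Theta> holomorphic_on strip (1/2)"
    and \<Theta>_strip: "\<And>z. z \<in> strip (1/2) \<Longrightarrow> \<Theta> z \<in> strip 1"
    and d\<Theta>: "\<And>z. z \<in> strip (1/2) \<Longrightarrow> (\<Theta> has_field_derivative inverse (P (\<Theta> z))) (at z)"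
    and \<Theta>_near: "\<And>z. z \<in> strip (1/2) \<Longrightarrow> cmod (\<Theta> z - z) \<le> 5 * (32 * \<epsilon>)"
    and \<Theta>_odd: "\<And>z. z \<in> strip (1/2) \<Longrightarrow> \<Theta> (- z) = - \<Theta> z"
    and \<Theta>_per: "\<And>z. z \<in> strip (1/2) \<Longrightarrow> \<Theta> (z + of_real (2*pi)) = \<Theta> z + of_real (2*pi)"
    and \<Theta>_real: "\<And>x. \<Theta> (of_real x) \<in> \<real>"
    using perturbed_identity_inverse[OF P_hol P_per P_even _ P_near small P_mean] P_real by (metis Reals_of_real)
  have d\<Theta>': "(\<Theta> has_field_derivative csqrt (w (\<Theta> z))) (at z)" if "z \<in> strip (1/2)" for z
    using d\<Theta>[OF that] by (simp add: P_def)
  define a where "a = sqrt s"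
  have a2: "a\<^sup>2 = s" "0 < a" using s by (auto simp: a_def)
  define f where "f z = of_real a * sin (\<Theta> z)" for z
  define f' where "f' z = of_real a * (cos (\<Theta> z) * csqrt (w (\<Theta> z)))" for z
  show ?thesis
  proof (rule that)
    show "f holomorphic_on strip (1/2)" unfolding f_def by (intro holomorphic_intros \<Theta>_hol)
    fix z assume z: "z \<in> strip (1/2)"
    note \<theta> = \<Theta>_strip[OF z]
    show "(f has_field_derivative f' z) (at z)"
      unfolding f_def f'_def by (rule derivative_eq_intros d\<Theta>'[OF z] refl)+ simp
    let ?\<sigma> = "(sin (\<Theta> z))\<^sup>2"
    have "((\<lambda>z. csqrt (w (\<Theta> z))) has_field_derivative
        inverse (2 * csqrt (w (\<Theta> z))) * (- (deriv H ?\<sigma> * (2 * sin (\<Theta> z) * cos (\<Theta> z))) * csqrt (w (\<Theta> z)))) (at z)"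
      by (rule DERIV_chain2[where f = csqrt and g = "\<lambda>z. w (\<Theta> z)", OF has_field_derivative_csqrt[OF w_nn[OF \<theta>]]
            DERIV_chain2[where f = w and g = \<Theta>, OF dw[OF \<theta>] d\<Theta>'[OF z]]])
    then have dq: "((\<lambda>z. csqrt (w (\<Theta> z))) has_field_derivative - (deriv H ?\<sigma> * sin (\<Theta> z) * cos (\<Theta> z))) (at z)"
      using w_nz[OF \<theta>] by (simp add: field_simps)
    have "(f' has_field_derivative of_real a * (- sin (\<Theta> z) * csqrt (w (\<Theta> z)) * csqrt (w (\<Theta> z))
        + cos (\<Theta> z) * - (deriv H ?\<sigma> * sin (\<Theta> z) * cos (\<Theta> z)))) (at z)"
      unfolding f'_def by (rule derivative_eq_intros d\<Theta>'[OF z] dq refl)+ (simp add: algebra_simps)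
    moreover have "of_real a * (- sin (\<Theta> z) * csqrt (w (\<Theta> z)) * csqrt (w (\<Theta> z))
        + cos (\<Theta> z) * - (deriv H ?\<sigma> * sin (\<Theta> z) * cos (\<Theta> z)))
      = ((\<Sum>k. of_real (b k) * ((f z)\<^sup>2) ^ k) - of_real (1 + \<epsilon>)) * f z"
    proof -
      \<comment> \<open>With $w = 1 + \varepsilon - h$ and $\cos^2 = 1 - \sigma$ the second derivative is $-f (1 + \varepsilon - (h - (1 - \sigma) h'))$.\<close>
      have 1: "csqrt (w (\<Theta> z)) * csqrt (w (\<Theta> z)) = 1 + (of_real \<epsilon> - H ?\<sigma>)"
        by (simp add: power2_eq_square[symmetric] w_def)
      have 2: "cos (\<Theta> z) * cos (\<Theta> z) = 1 - ?\<sigma>"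
        by (simp add: power2_eq_square[symmetric] cos_squared_eq)
      have "(f z)\<^sup>2 = of_real s * ?\<sigma>" by (simp add: f_def power_mult_distrib a2 flip: of_real_power)
      then have 3: "(\<Sum>k. of_real (b k) * ((f z)\<^sup>2) ^ k) = H ?\<sigma> - (1 - ?\<sigma>) * deriv H ?\<sigma>"
        unfolding H_def using secant_series_ode[OF sR' sin9[OF \<theta>]] by simp
      have "of_real a * (- sin (\<Theta> z) * csqrt (w (\<Theta> z)) * csqrt (w (\<Theta> z))
        + cos (\<Theta> z) * - (deriv H ?\<sigma> * sin (\<Theta> z) * cos (\<Theta> z)))
        = - f z * (csqrt (w (\<Theta> z)) * csqrt (w (\<Theta> z)) + deriv H ?\<sigma> * (cos (\<Theta> z) * cos (\<Theta> z)))"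
        by (simp add: f_def algebra_simps)
      then show ?thesis unfolding 1 2 3 by (simp add: algebra_simps)
    qed
    ultimately show "(f' has_field_derivative ((\<Sum>k. of_real (b k) * ((f z)\<^sup>2) ^ k) - of_real (1 + \<epsilon>)) * f z) (at z)"
      by simp
    show "f (z + of_real (2*pi)) = f z" unfolding f_def \<Theta>_per[OF z] by (simp only: sin_plus_2pi_complex)
    show "f (- z) = - f z" unfolding f_def \<Theta>_odd[OF z] by simp
    show "cmod (f z - of_real (sqrt (4 * \<epsilon> / (3 * \<beta>))) * sin z) \<le> profile_const * \<epsilon> * sqrt \<epsilon>"
    proof -
      define c where "c = sqrt (4 / (3 * \<beta>))"
      have c: "c > 0" using \<beta> by (simp add: c_def)
      \<comment> \<open>The difference of the square roots is controlled by $(a - a_0)(a + a_0) = s - a_0^2$ and $a_0 \sim \sqrt\varepsilon$.\<close>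
      define a0 where "a0 = sqrt (4 * \<epsilon> / (3 * \<beta>))"
      have a0: "a0 = c * sqrt \<epsilon>" by (simp add: a0_def c_def real_sqrt_mult real_sqrt_divide)
      have a02: "a0\<^sup>2 = 4 * \<epsilon> / (3 * \<beta>)" using \<epsilon>0 \<beta> by (simp add: a0_def)
      have a00: "0 < a0" using a0 c \<epsilon>0 by simp
      have "(a - a0) * (a + a0) = s - 4 * \<epsilon> / (3 * \<beta>)"
        using a2 a02 by (simp add: algebra_simps power2_eq_square)
      then have "\<bar>a - a0\<bar> * (a + a0) \<le> 16 * period_const / (3 * \<beta>) * \<epsilon>\<^sup>2"
        using s_approx a00 a2 by (metis abs_mult abs_of_pos add_pos_pos)
      moreover have "\<bar>a - a0\<bar> * a0 \<le> \<bar>a - a0\<bar> * (a + a0)" using a2 by (intro mult_left_mono) auto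
      ultimately have "\<bar>a - a0\<bar> * a0 \<le> 16 * period_const / (3 * \<beta>) * \<epsilon>\<^sup>2" by linarith
      then have "\<bar>a - a0\<bar> \<le> 16 * period_const / (3 * \<beta>) * \<epsilon>\<^sup>2 / a0" by (simp only: pos_le_divide_eq[OF a00])
      also have "\<dots> = 16 * period_const / (3 * \<beta>) / c * (\<epsilon> * sqrt \<epsilon>)"
      proof -
        have "\<epsilon>\<^sup>2 / sqrt \<epsilon> = \<epsilon> * sqrt \<epsilon>" using \<epsilon>0 by (simp add: power2_eq_square real_div_sqrt flip: times_divide_eq_right)
        then have "16 * period_const / (3 * \<beta>) / c * (\<epsilon> * sqrt \<epsilon>) = 16 * period_const / (3 * \<beta>) / c * (\<epsilon>\<^sup>2 / sqrt \<epsilon>)"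
          by simp
        then show ?thesis unfolding a0 by simp
      qed
      finally have da: "\<bar>a - a0\<bar> \<le> 16 * period_const / (3 * \<beta>) / c * (\<epsilon> * sqrt \<epsilon>)" .
      have z1: "z \<in> strip 1" using z by simp
      have "cmod (sin (\<Theta> z) - sin z) \<le> 3 * cmod (\<Theta> z - z)" by (rule sin_lipschitz_strip[OF \<theta> z1])
      also have "\<dots> \<le> 480 * \<epsilon>" using \<Theta>_near[OF z] by simp
      finally have ds: "cmod (sin (\<Theta> z) - sin z) \<le> 480 * \<epsilon>" .
      have "f z - of_real a0 * sin z = of_real (a - a0) * sin (\<Theta> z) + of_real a0 * (sin (\<Theta> z) - sin z)"
        by (simp add: f_def algebra_simps)
      also have "cmod \<dots> \<le> cmod (of_real (a - a0) * sin (\<Theta> z)) + cmod (of_real a0 * (sin (\<Theta> z) - sin z))"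
        by (rule norm_triangle_ineq)
      also have "\<dots> = \<bar>a - a0\<bar> * cmod (sin (\<Theta> z)) + a0 * cmod (sin (\<Theta> z) - sin z)"
        using a00 by (simp add: norm_mult flip: of_real_diff)
      also have "\<dots> \<le> (16 * period_const / (3 * \<beta>) / c * (\<epsilon> * sqrt \<epsilon>)) * 3 + a0 * (480 * \<epsilon>)"
        using da ds norm_sin_cos_strip(1)[OF \<theta>] a00 by (intro add_mono mult_mono) auto
      also have "\<dots> = profile_const * \<epsilon> * sqrt \<epsilon>"
        unfolding profile_const_def a0 c_def[symmetric] by (simp add: algebra_simps)
      finally show ?thesis by (simp add: a0_def)
    qed
  next
    fix x
    obtain t where t: "\<Theta> (of_real x) = of_real t" using \<Theta>_real[of x] by (auto elim: Reals_cases)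
    have ft: "f (of_real x) = of_real (a * sin t)" by (simp add: f_def t sin_of_real)
    show "f (of_real x) \<in> \<real>" unfolding ft by simp
    have "(cmod (f (of_real x)))\<^sup>2 = s * (sin t)\<^sup>2" unfolding ft norm_of_real by (simp add: power_mult_distrib a2)
    also have "\<dots> \<le> s * 1" using s by (intro mult_left_mono) (auto simp: abs_square_le_1)
    finally show "(cmod (f (of_real x)))\<^sup>2 \<le> 8 * \<epsilon> / (3 * \<beta>)" using s by simp
  qed
qed

end

section \<open>Analyticity and Fourier data of a wave with a single time frequency\<close>

lemma has_sum_product_nat:
  fixes A B :: "nat \<Rightarrow> complex"
  assumes A: "summable (\<lambda>j. norm (A j))" "A sums a" and B: "summable (\<lambda>k. norm (B k))" "B sums b"
  shows "((\<lambda>(j, k). A j * B k) has_sum (a * b)) UNIV"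
proof -
  have hA: "(A has_sum a) UNIV" and hB: "(B has_sum b) UNIV"
    using norm_summable_imp_has_sum A B by blast+
  have nA: "(\<lambda>j. norm (A j)) summable_on UNIV" and nB: "(\<lambda>k. norm (B k)) summable_on UNIV"
    using A(1) B(1) by (auto intro!: norm_summable_imp_summable_on)
  have "(\<lambda>p. norm (case p of (j, k) \<Rightarrow> A j * B k)) summable_on (UNIV \<times> UNIV)"
  proof (rule summable_on_SigmaI)
    show "((\<lambda>k. norm (case (j, k) of (j, k) \<Rightarrow> A j * B k)) has_sum (norm (A j) * infsum (\<lambda>k. norm (B k)) UNIV)) UNIV" for j
      using has_sum_cmult_right[OF has_sum_infsum[OF nB]] by (simp add: norm_mult)
    show "(\<lambda>j. norm (A j) * infsum (\<lambda>k. norm (B k)) UNIV) summable_on UNIV"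
      by (rule summable_on_cmult_left[OF nA])
  qed auto
  then have s: "(\<lambda>p. case p of (j, k) \<Rightarrow> A j * B k) summable_on (UNIV \<times> UNIV)"
    by (rule abs_summable_summable)
  have "((\<lambda>p. case p of (j, k) \<Rightarrow> A j * B k) has_sum (a * b)) (UNIV \<times> UNIV)"
    by (rule has_sum_SigmaI[where g = "\<lambda>j. A j * b"]) (use has_sum_cmult_right[OF hB] has_sum_cmult_left[OF hA] s in auto)
  then show ?thesis by simp
qed

lemma jointly_analytic_exp_times_holomorphic:
  fixes l :: real
  assumes \<rho>: "\<rho> > 0" and f: "f holomorphic_on strip \<rho>"
  shows "jointly_analytic (\<lambda>t x. c * exp (\<i> * of_real (l * t)) * f (of_real x))"
  unfolding jointly_analytic_def
proof (intro allI)
  fix t0 x0 :: real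
  define d where "d k = (deriv ^^ k) f (of_real x0) / fact k" for k
  define e where "e j = c * exp (\<i> * of_real (l * t0)) * ((\<i> * of_real l) ^ j / fact j)" for j
  have sub: "ball (of_real x0) \<rho> \<subseteq> strip \<rho>"
  proof
    fix z :: complex assume "z \<in> ball (of_real x0) \<rho>"
    then have "cmod (z - of_real x0) < \<rho>" by (simp add: dist_norm norm_minus_commute)
    then show "z \<in> strip \<rho>" using abs_Im_le_cmod[of "z - of_real x0"] by simp
  qed
  have ser: "(\<lambda>k. d k * y ^ k) sums f (of_real x0 + y)" if "cmod y < \<rho>" for y
    using holomorphic_power_series[OF holomorphic_on_subset[OF f sub], of "of_real x0 + y"] that
    by (simp add: d_def dist_norm)
  show "\<exists>r>0. \<exists>C. \<forall>t x. \<bar>t - t0\<bar> < r \<longrightarrow> \<bar>x - x0\<bar> < r \<longrightarrow>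
      ((\<lambda>(j, k). C j k * of_real ((t - t0) ^ j * (x - x0) ^ k)) has_sum
        c * exp (\<i> * of_real (l * t)) * f (of_real x)) UNIV"
  proof (rule exI[of _ "\<rho> / 2"], intro conjI exI[of _ "\<lambda>j k. e j * d k"] allI impI)
    fix t x assume "\<bar>t - t0\<bar> < \<rho> / 2" and x: "\<bar>x - x0\<bar> < \<rho> / 2"
    let ?T = "of_real (t - t0) :: complex" and ?X = "of_real (x - x0) :: complex"
    have s: "summable (\<lambda>k. d k * (of_real (\<rho> / 2)) ^ k)"
      using ser[of "of_real (\<rho> / 2)"] \<rho> by (intro sums_summable) (simp only: norm_of_real, simp)
    have X1: "summable (\<lambda>k. norm (d k * ?X ^ k))"
    proof (rule powser_insidea[OF s])
      show "norm ?X < norm (of_real (\<rho> / 2) :: complex)" unfolding norm_of_real using x \<rho> by simp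
    qed
    have X2: "(\<lambda>k. d k * ?X ^ k) sums f (of_real x)"
      using ser[of ?X] x \<rho> by (simp only: norm_of_real) simp
    have eq: "e j * ?T ^ j = (c * exp (\<i> * of_real (l * t0))) * ((\<i> * of_real l * ?T) ^ j /\<^sub>R fact j)" for j
      by (simp only: e_def power_mult_distrib scaleR_conv_of_real) (simp add: divide_inverse mult_ac)
    have T1: "summable (\<lambda>j. norm (e j * ?T ^ j))"
      unfolding eq norm_mult[of "c * _"] by (intro summable_mult summable_norm_exp)
    have "exp (\<i> * of_real (l * t0)) * exp (\<i> * of_real l * ?T) = exp (\<i> * of_real (l * t))"
      unfolding exp_add[symmetric] by (rule arg_cong[where f = exp]) (simp add: algebra_simps)
    then have T2: "(\<lambda>j. e j * ?T ^ j) sums (c * exp (\<i> * of_real (l * t)))"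
      unfolding eq using sums_mult[OF exp_converges[of "\<i> * of_real l * ?T"], of "c * exp (\<i> * of_real (l * t0))"]
      by (simp add: mult.assoc)
    show "((\<lambda>(j, k). e j * d k * of_real ((t - t0) ^ j * (x - x0) ^ k)) has_sum
        c * exp (\<i> * of_real (l * t)) * f (of_real x)) UNIV"
      using has_sum_product_nat[OF T1 T2 X1 X2] by (simp add: mult_ac)
  qed (use \<rho> in simp)
qed

lemma fourier_coeff_single_frequency:
  fixes N :: int and d :: "complex \<Rightarrow> complex"
  shows "fourier_coeff (\<lambda>t x. \<i> * exp (\<i> * of_real (of_int N * t)) * d (of_real x)) n m
    = (if n = N then \<i> * fcoeff d m else 0)"
proof -
  have inner: "integral {0..2*pi} (\<lambda>x. \<i> * exp (\<i> * of_real (of_int N * t)) * d (of_real x)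
        * exp (- \<i> * of_real (of_int n * t + of_int m * x)))
      = \<i> * (of_real (2*pi) * fcoeff d m) * exp (- \<i> * of_int (n - N) * of_real t)" for t
  proof -
    have "exp (\<i> * of_real (of_int N * t)) * exp (- \<i> * of_real (of_int n * t + of_int m * x))
        = exp (- \<i> * of_int (n - N) * of_real t) * exp (- \<i> * of_int m * of_real x)" for x
      unfolding exp_add[symmetric] by (rule arg_cong[where f = exp]) (simp add: algebra_simps)
    note E = this
    have "\<i> * exp (\<i> * of_real (of_int N * t)) * d (of_real x) * exp (- \<i> * of_real (of_int n * t + of_int m * x))
        = \<i> * exp (- \<i> * of_int (n - N) * of_real t) * (d (of_real x) * exp (- \<i> * of_int m * of_real x))" for x
    proof -
      have "\<i> * exp (\<i> * of_real (of_int N * t)) * d (of_real x) * exp (- \<i> * of_real (of_int n * t + of_int m * x))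
          = \<i> * d (of_real x) * (exp (\<i> * of_real (of_int N * t)) * exp (- \<i> * of_real (of_int n * t + of_int m * x)))"
        by (simp only: mult_ac)
      then show ?thesis unfolding E by (simp only: mult_ac)
    qed
    then have "integral {0..2*pi} (\<lambda>x. \<i> * exp (\<i> * of_real (of_int N * t)) * d (of_real x)
        * exp (- \<i> * of_real (of_int n * t + of_int m * x)))
      = \<i> * exp (- \<i> * of_int (n - N) * of_real t) * integral {0..2*pi} (\<lambda>x. d (of_real x) * exp (- \<i> * of_int m * of_real x))"
      by (simp only: integral_mult_right)
    then show ?thesis by (simp add: fcoeff_def mult_ac)
  qed
  have "integral {0..2*pi} (\<lambda>t. \<i> * (of_real (2*pi) * fcoeff d m) * exp (- \<i> * of_int (n - N) * of_real t))
     = \<i> * (of_real (2*pi) * fcoeff d m) * (if n - N = 0 then of_real (2*pi) else 0)"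
    by (intro integral_unique has_integral_mult_right has_integral_exp_int)
  note outer = this
  show ?thesis
    unfolding fourier_coeff_def inner outer by (cases "n = N") (simp_all add: power2_eq_square)
qed

lemma infsum_ennreal:
  fixes f :: "'a \<Rightarrow> real"
  assumes "f summable_on A" "\<And>x. x \<in> A \<Longrightarrow> 0 \<le> f x"
  shows "infsum (\<lambda>x. ennreal (f x)) A = ennreal (infsum f A)"
proof -
  have "infsum (\<lambda>x. ennreal (f x)) A = (SUP F\<in>{F. finite F \<and> F \<subseteq> A}. sum (\<lambda>x. ennreal (f x)) F)"
    by (rule nonneg_infsum_complete) simp
  also have "\<dots> = (SUP F\<in>{F. finite F \<and> F \<subseteq> A}. ennreal (sum f F))"
    by (rule SUP_cong) (auto intro!: sum_ennreal assms(2))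
  also have "\<dots> = ennreal (infsum f A)"
    using infsum_nonneg_is_SUPREMUM_ennreal[OF assms] by simp
  finally show ?thesis .
qed

text \<open>
  Half of the decay rate is spent on the weight of the norm, the other half on the summation.
\<close>
lemma fourier_norm_single_frequency_le:
  fixes N :: int and c B :: real
  assumes c: "c > 0" and dec: "\<And>m. cmod (fcoeff d m) \<le> B * exp (- c * \<bar>m\<bar>)"
  shows "fourier_norm (c / 2) (\<lambda>t x. \<i> * exp (\<i> * of_real (of_int N * t)) * d (of_real x))
    \<le> ennreal (B * (exp (c / 2 * \<bar>N\<bar>) * (\<Sum>\<^sub>\<infinity>m::int. exp (- (c / 2) * \<bar>m\<bar>))))"
proof -
  define F where "F = (\<lambda>t x. \<i> * exp (\<i> * of_real (of_int N * t)) * d (of_real x))"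
  have coeff: "fourier_coeff F n m = (if n = N then \<i> * fcoeff d m else 0)" for n m
    unfolding F_def by (rule fourier_coeff_single_frequency)
  let ?g = "\<lambda>(n, m). ennreal (cmod (fourier_coeff F n m) * exp (c / 2 * of_int (\<bar>n\<bar> + \<bar>m\<bar>)))"
  have B0: "B \<ge> 0" using dec[of 0] by (simp add: order_trans[OF norm_ge_zero])
  have sm: "(\<lambda>m::int. exp (- (c / 2) * \<bar>m\<bar>)) summable_on UNIV"
    using summable_int_exp[of "c / 2"] c by simp
  have "fourier_norm (c / 2) F = infsum ?g UNIV" by (simp add: fourier_norm_def)
  also have "\<dots> = infsum ?g (range (Pair N))"
    by (rule infsum_cong_neutral) (auto simp: coeff)
  also have "\<dots> = (\<Sum>\<^sub>\<infinity>m. ?g (N, m))"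
    by (subst infsum_reindex) (auto simp: inj_on_def o_def)
  also have "\<dots> \<le> (\<Sum>\<^sub>\<infinity>m::int. ennreal (B * exp (c / 2 * \<bar>N\<bar>) * exp (- (c / 2) * \<bar>m\<bar>)))"
    (is "_ \<le> infsum ?h UNIV")
  proof (rule infsum_mono)
    fix m :: int
    have "cmod (fcoeff d m) * exp (c / 2 * of_int (\<bar>N\<bar> + \<bar>m\<bar>))
        \<le> B * exp (- c * \<bar>m\<bar>) * exp (c / 2 * of_int (\<bar>N\<bar> + \<bar>m\<bar>))"
      by (intro mult_right_mono dec) simp
    also have "\<dots> = B * exp (c / 2 * \<bar>N\<bar>) * exp (- (c / 2) * \<bar>m\<bar>)"
    proof -
      have "exp (- c * \<bar>m\<bar>) * exp (c / 2 * of_int (\<bar>N\<bar> + \<bar>m\<bar>)) = exp (c / 2 * \<bar>N\<bar>) * exp (- (c / 2) * \<bar>m\<bar>)"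
        unfolding exp_add[symmetric] by (rule arg_cong[where f = exp]) (simp add: field_simps)
      then show ?thesis by (simp only: mult.assoc)
    qed
    finally show "?g (N, m) \<le> ?h m"
      by (simp add: coeff norm_mult ennreal_leI)
  qed (rule nonneg_summable_on_complete, simp)+
  also have "\<dots> = ennreal (\<Sum>\<^sub>\<infinity>m::int. B * exp (c / 2 * \<bar>N\<bar>) * exp (- (c / 2) * \<bar>m\<bar>))"
    by (intro infsum_ennreal summable_on_cmult_right sm) (use B0 in auto)
  also have "(\<Sum>\<^sub>\<infinity>m::int. B * exp (c / 2 * \<bar>N\<bar>) * exp (- (c / 2) * \<bar>m\<bar>))
      = B * (exp (c / 2 * \<bar>N\<bar>) * (\<Sum>\<^sub>\<infinity>m::int. exp (- (c / 2) * \<bar>m\<bar>)))"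
    by (simp add: infsum_cmult_right' mult.assoc)
  finally show ?thesis unfolding F_def .
qed

text \<open>
  The coefficients are antisymmetrised explicitly, which for an odd function does not change the
  sum.
\<close>
lemma odd_fourier_form_single_frequency:
  fixes N :: int
  assumes v: "periodic_on_strip v \<rho>" and odd: "\<And>x. v (of_real (- x)) = - v (of_real x)"
  shows "odd_fourier_form w (\<lambda>t x. \<i> * exp (\<i> * of_real (of_int N * (w * t))) * v (of_real x))"
proof -
  interpret v: periodic_on_strip v \<rho> by (rule v)
  define U where "U n m = (if n = N then \<i> * ((fcoeff v m - fcoeff v (- m)) / 2) else 0)" for n m
  have "((\<lambda>(n, m). U n m * exp (\<i> * of_real (of_int n * w * t + of_int m * x))) has_sum
      \<i> * exp (\<i> * of_real (of_int N * (w * t))) * v (of_real x)) UNIV" for t x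
  proof -
    let ?g = "\<lambda>(n, m). U n m * exp (\<i> * of_real (of_int n * w * t + of_int m * x))"
    let ?E = "\<lambda>m x. exp (\<i> * of_int m * of_real x) :: complex"
    have 1: "((\<lambda>m. fcoeff v m * ?E m x) has_sum v (of_real x)) UNIV" by (rule v.fourier_series)
    have "((\<lambda>m. fcoeff v m * ?E m (- x)) has_sum v (of_real (- x))) UNIV" by (rule v.fourier_series)
    then have 2: "((\<lambda>m. fcoeff v (- m) * ?E m x) has_sum v (of_real (- x))) UNIV"
      by (subst (asm) has_sum_reindex_bij_witness[where i = uminus and j = uminus and T = UNIV
            and h = "\<lambda>m. fcoeff v (- m) * ?E m x"]) auto
    have "((\<lambda>m. fcoeff v m * ?E m x - fcoeff v (- m) * ?E m x) has_sum (v (of_real x) - v (of_real (- x)))) UNIV"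
      using has_sum_add[OF 1 has_sum_cmult_right[OF 2, of "- 1"]] by simp
    then have "((\<lambda>m. fcoeff v m * ?E m x - fcoeff v (- m) * ?E m x) has_sum (2 * v (of_real x))) UNIV"
      unfolding odd by simp
    from has_sum_cmult_right[OF this, of "\<i> * exp (\<i> * of_real (of_int N * (w * t))) / 2"]
    have "((\<lambda>m. \<i> * exp (\<i> * of_real (of_int N * (w * t))) / 2 * (fcoeff v m * ?E m x - fcoeff v (- m) * ?E m x))
        has_sum (\<i> * exp (\<i> * of_real (of_int N * (w * t))) * v (of_real x))) UNIV"
      by (simp add: mult.assoc)
    moreover have "\<i> * exp (\<i> * of_real (of_int N * (w * t))) / 2 * (fcoeff v m * ?E m x - fcoeff v (- m) * ?E m x)
        = ?g (N, m)" for m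
    proof -
      have "exp (\<i> * of_real (of_int N * (w * t))) * ?E m x = exp (\<i> * of_real (of_int N * w * t + of_int m * x))"
        unfolding exp_add[symmetric] by (rule arg_cong[where f = exp]) (simp add: algebra_simps)
      moreover have "\<i> * p / 2 * (a * q - b * q) = \<i> * ((a - b) / 2) * (p * q)" for a b p q :: complex
        by (simp add: field_simps)
      ultimately show ?thesis by (simp only: prod.case U_def if_True refl)
    qed
    ultimately have "((\<lambda>m. ?g (N, m)) has_sum (\<i> * exp (\<i> * of_real (of_int N * (w * t))) * v (of_real x))) UNIV"
      by simp
    then have "(?g has_sum (\<i> * exp (\<i> * of_real (of_int N * (w * t))) * v (of_real x))) (range (Pair N))"
      by (subst has_sum_reindex) (auto simp: inj_on_def o_def)
    then show ?thesis
      by (rule has_sum_cong_neutral[THEN iffD1, rotated -1]) (auto simp: U_def)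
  qed
  moreover have "U n (- m) = - U n m" for n m by (simp add: U_def field_simps)
  ultimately show ?thesis unfolding odd_fourier_form_def by blast
qed

section \<open>Rotating waves as solutions of the nonlinear Schroedinger equation\<close>

text \<open>
  The condition on \<open>\<phi>\<close> concerns the punctured neighbourhood of 0 only;
  $\varphi(0) = 0$ follows by continuity.
\<close>
lemma power_series_leading_coefficients:
  fixes \<phi> :: "real \<Rightarrow> real"
  assumes r: "r > 0" and ser: "\<And>x. \<bar>x\<bar> < r \<Longrightarrow> (\<lambda>k. c k * x ^ k) sums \<phi> x"
    and bigo: "(\<lambda>x. \<phi> x - \<Phi> * x) \<in> O[at 0](\<lambda>x. x\<^sup>2)"
  shows "c 0 = 0" "c 1 = \<Phi>"
proof -
  define g where "g x = (\<Sum>k. c k * x ^ k)" for x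
  have g: "g x = \<phi> x" if "\<bar>x\<bar> < r" for x using ser[OF that] by (simp add: g_def sums_iff)
  have "summable (\<lambda>k. c k * (r / 2) ^ k)" using ser[of "r / 2"] r by (simp add: sums_iff)
  from termdiffs_strong[OF this, of 0]
  have dg: "(g has_field_derivative c 1) (at 0)"
    using r unfolding g_def by (simp add: powser_zero diffs_def)
  then have d: "(\<phi> has_field_derivative c 1) (at 0)"
    by (rule has_field_derivative_transform_within_open[of _ _ _ "ball 0 r"]) (use r g in auto)
  obtain K where K: "eventually (\<lambda>x. \<bar>\<phi> x - \<Phi> * x\<bar> \<le> K * x\<^sup>2) (at 0)"
    using bigo by (elim landau_o.bigE) (simp add: norm_power)
  have "((\<lambda>x. K * x\<^sup>2) \<longlongrightarrow> K * 0\<^sup>2) (at (0::real))" by (intro tendsto_intros)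
  then have lim: "((\<lambda>x. K * x\<^sup>2) \<longlongrightarrow> 0) (at (0::real))" by simp
  have "((\<lambda>x. \<phi> x - \<Phi> * x) \<longlongrightarrow> 0) (at 0)"
    by (rule Lim_null_comparison[OF _ lim]) (simp only: real_norm_def K)
  moreover have "((\<lambda>x. \<phi> x - \<Phi> * x) \<longlongrightarrow> \<phi> 0 - \<Phi> * 0) (at 0)"
    using DERIV_isCont[OF d] by (intro tendsto_intros) (simp add: isCont_def)
  ultimately have \<phi>0: "\<phi> 0 = 0" using tendsto_unique[OF at_neq_bot] by fastforce
  then show "c 0 = 0" using ser[of 0] r by (simp add: sums_iff powser_zero)
  have "((\<lambda>x. K * \<bar>x\<bar>) \<longlongrightarrow> K * \<bar>0\<bar>) (at (0::real))" by (intro tendsto_intros)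
  then have lim: "((\<lambda>x. K * \<bar>x\<bar>) \<longlongrightarrow> 0) (at (0::real))" by simp
  have "eventually (\<lambda>x. norm (\<phi> x / x - \<Phi>) \<le> K * \<bar>x\<bar>) (at 0)"
    using K eventually_neq_at_within[of 0]
  proof eventually_elim
    case (elim x)
    have "\<phi> x / x - \<Phi> = (\<phi> x - \<Phi> * x) / x" using elim by (simp add: field_simps)
    then have "norm (\<phi> x / x - \<Phi>) = \<bar>\<phi> x - \<Phi> * x\<bar> / \<bar>x\<bar>" by simp
    also have "\<dots> \<le> K * x\<^sup>2 / \<bar>x\<bar>" using elim by (intro divide_right_mono) auto
    also have "\<dots> = K * \<bar>x\<bar>" using elim by (simp add: power2_eq_square abs_if)
    finally show ?case .
  qed
  then have "((\<lambda>x. \<phi> x / x - \<Phi>) \<longlongrightarrow> 0) (at 0)"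
    by (rule Lim_null_comparison[OF _ lim])
  then have "((\<lambda>x. \<phi> x / x) \<longlongrightarrow> \<Phi>) (at 0)" by (simp add: LIM_zero_iff)
  moreover have "((\<lambda>x. \<phi> x / x) \<longlongrightarrow> c 1) (at 0)"
    using d \<phi>0 by (simp add: DERIV_def)
  ultimately show "c 1 = \<Phi>" using tendsto_unique[OF at_neq_bot] by blast
qed

lemma wave_u0_eq:
  "wave_u0 m t x = \<i> * exp (\<i> * of_real (real (m\<^sup>2) * t)) * (of_real (2 * real m / sqrt 3) * sin (of_nat m * of_real x))"
proof -
  have "sin (of_nat m * of_real x :: complex) = (exp (\<i> * of_real (real m * x)) - exp (\<i> * of_real (real m * - x))) / (2 * \<i>)"
    by (simp add: sin_exp_eq)
  then have "exp (\<i> * of_real (real m * x)) - exp (\<i> * of_real (real m * - x)) = 2 * \<i> * sin (of_nat m * of_real x :: complex)"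
    by simp
  moreover have "wave_u0 m t x = of_real (real m / sqrt 3) * exp (\<i> * of_real (real (m\<^sup>2) * t))
      * (exp (\<i> * of_real (real m * x)) - exp (\<i> * of_real (real m * - x)))"
    by (simp only: wave_u0_def wave_a_def right_diff_distrib of_nat_power)
  ultimately show ?thesis by (simp only:) (simp add: mult_ac)
qed

text \<open>
  A rotating wave solves the evolution equation as soon as its profile solves the stationary
  equation. The hypothesis on \<open>g\<close> says that $m^2 g = \varphi(|f|^2)$ on the real
  line; off the real line \<open>g\<close> is unrestricted apart from the differential equation.
\<close>
lemma rotating_wave_is_solution:
  fixes \<phi> :: "real \<Rightarrow> real" and m :: nat and \<omega> \<rho> :: real
  assumes \<rho>: "\<rho> > 0"
    and df: "\<And>z. z \<in> strip \<rho> \<Longrightarrow> (f has_field_derivative f' z) (at z)"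
    and df': "\<And>z. z \<in> strip \<rho> \<Longrightarrow> (f' has_field_derivative (g z - of_real \<omega>) * f z) (at z)"
    and g: "\<And>x. of_nat (m\<^sup>2) * g (of_real x) = of_real (\<phi> ((cmod (f (of_real x)))\<^sup>2))"
    and D: "\<And>x. (cmod (f (of_real x)))\<^sup>2 \<in> D"
    and zero: "f 0 = 0" "f (of_real (real m * pi)) = 0"
  shows "dirichlet_nls_solution \<phi> D (\<lambda>t x. \<i> * exp (\<i> * of_real (real (m\<^sup>2) * (\<omega> * t))) * f (of_real (real m * x)))"
    (is "dirichlet_nls_solution \<phi> D ?u")
proof -
  define e where "e t = \<i> * exp (\<i> * of_real (real (m\<^sup>2) * (\<omega> * t)))" for t
  have u: "?u = (\<lambda>t x. e t * f (of_real (real m * x)))" by (simp add: e_def)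
  have e1: "cmod (e t) = 1" for t by (simp add: e_def norm_mult)
  have de: "(e has_vector_derivative \<i> * of_real (real (m\<^sup>2) * \<omega>) * e t) (at t)" for t
  proof -
    have "((\<lambda>z. \<i> * exp (\<i> * of_real (real (m\<^sup>2) * \<omega>) * z)) has_field_derivative
        \<i> * of_real (real (m\<^sup>2) * \<omega>) * (\<i> * exp (\<i> * of_real (real (m\<^sup>2) * \<omega>) * of_real t))) (at (of_real t))"
      by (auto intro!: derivative_eq_intros)
    from has_vector_derivative_real_field[OF this]
    show ?thesis by (simp add: e_def[abs_def] mult_ac)
  qed
  have chain: "((\<lambda>y. h (of_real (real m * y))) has_vector_derivative of_nat m * h') (at x)"
    if "(h has_field_derivative h') (at (of_real (real m * x)))" for h h' x
  proof -
    have "((\<lambda>z. h (of_nat m * z)) has_field_derivative h' * of_nat m) (at (of_real x))"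
      by (rule DERIV_chain2[where f = h and g = "\<lambda>z. of_nat m * z"])
        (use that in \<open>auto intro!: derivative_eq_intros\<close>)
    from has_vector_derivative_real_field[OF this] show ?thesis by (simp add: mult.commute)
  qed
  define ut where "ut t x = \<i> * of_real (real (m\<^sup>2) * \<omega>) * e t * f (of_real (real m * x))" for t x
  define ux where "ux t x = e t * (of_nat m * f' (of_real (real m * x)))" for t x
  define uxx where "uxx t x = e t * (of_nat m * (of_nat m * ((g (of_real (real m * x)) - of_real \<omega>) * f (of_real (real m * x)))))" for t x
  have "((\<lambda>s. e s * f (of_real (real m * x))) has_vector_derivative ut t x) (at t) \<and>
      ((\<lambda>y. e t * f (of_real (real m * y))) has_vector_derivative ux t x) (at x) \<and>
      ((\<lambda>y. ux t y) has_vector_derivative uxx t x) (at x) \<and>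
      - \<i> * ut t x + uxx t x
        = of_real (\<phi> ((cmod (e t * f (of_real (real m * x))))\<^sup>2)) * (e t * f (of_real (real m * x)))" for t x
  proof (intro conjI)
    let ?y = "real m * x"
    show "((\<lambda>s. e s * f (of_real ?y)) has_vector_derivative ut t x) (at t)"
      unfolding ut_def by (rule has_vector_derivative_mult_left[OF de])
    show "((\<lambda>y. e t * f (of_real (real m * y))) has_vector_derivative ux t x) (at x)"
      unfolding ux_def by (intro has_vector_derivative_mult_right chain df) (use \<rho> in simp)
    show "((\<lambda>y. ux t y) has_vector_derivative uxx t x) (at x)"
      unfolding ux_def uxx_def by (intro has_vector_derivative_mult_right chain df') (use \<rho> in simp)
    have "- \<i> * ut t x + uxx t x = (of_nat (m\<^sup>2) * g (of_real ?y)) * (e t * f (of_real ?y))"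
      by (simp add: ut_def uxx_def algebra_simps power2_eq_square)
    then show "- \<i> * ut t x + uxx t x = of_real (\<phi> ((cmod (e t * f (of_real ?y)))\<^sup>2)) * (e t * f (of_real ?y))"
      unfolding g by (simp add: norm_mult e1)
  qed
  moreover have "(cmod (e t * f (of_real (real m * x))))\<^sup>2 \<in> D" for t x
    using D[of "real m * x"] by (simp add: norm_mult e1)
  moreover have "e t * f (of_real (real m * 0)) = 0" "e t * f (of_real (real m * pi)) = 0" for t
    using zero by simp_all
  ultimately show ?thesis
    unfolding dirichlet_nls_solution_def u by blast
qed

theorem theorem1:
  fixes \<phi> :: "real \<Rightarrow> real" and D :: "real set" and \<Phi> :: real and m0 :: nat
  assumes "open D" and "0 \<in> D"
    and "real_analytic_on \<phi> D"
    and "(\<lambda>x. \<phi> x - \<Phi> * x) \<in> O[at 0](\<lambda>x. x\<^sup>2)"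
    and "\<Phi> > 0"
    and "m0 > 0"
  shows "\<exists>\<epsilon>0>0. \<exists>E. E \<subseteq> {0..\<epsilon>0} \<and> E \<in> sets lebesgue \<and>
    ((\<lambda>\<epsilon>. measure lebesgue (E \<inter> {0..\<epsilon>}) / \<epsilon>) \<longlongrightarrow> 1) (at_right (0::real)) \<and>
    (\<exists>C>0. \<exists>\<kappa>>0. \<forall>\<epsilon>\<in>E. let \<omega> = 1 + \<epsilon> in
       \<exists>u. dirichlet_nls_solution \<phi> D u \<and>
           odd_fourier_form \<omega> u \<and>
           (\<forall>t x. u (t + 2 * pi / \<omega>) x = u t x) \<and>
           jointly_analytic u \<and>
           freq_norm \<omega> \<kappa> (\<lambda>t x. u t x - of_real (sqrt (\<epsilon> / \<Phi>)) * wave_u0 m0 (\<omega> * t) x)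
             \<le> ennreal (C * \<epsilon> * sqrt \<epsilon>))"
proof -
  obtain r c where r: "r > 0" and ser0: "\<And>x. \<bar>x - 0\<bar> < r \<Longrightarrow> (\<lambda>k. c k * (x - 0) ^ k) sums \<phi> x"
    using assms(2,3) unfolding real_analytic_on_def by blast
  then have ser: "\<And>x. \<bar>x\<bar> < r \<Longrightarrow> (\<lambda>k. c k * x ^ k) sums \<phi> x" by simp
  note c01 = power_series_leading_coefficients[OF r ser assms(4)]
  define M2 where "M2 = real (m0\<^sup>2)"
  have M2: "M2 > 0" using assms(6) by (simp add: M2_def)
  define \<beta> where "\<beta> = \<Phi> / M2"
  define b where "b k = c k / M2" for k
  have "summable (\<lambda>k. norm (c k * (r / 2) ^ k))"
  proof (rule powser_insidea)
    show "summable (\<lambda>k. c k * (3 / 4 * r) ^ k)" using ser[of "3 / 4 * r"] r by (simp add: sums_iff)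
  qed (use r in simp)
  then have "summable (\<lambda>k. norm (c k * (r / 2) ^ k) / M2)" by (rule summable_divide)
  then have "summable (\<lambda>k. \<bar>b k\<bar> * (r / 2) ^ k)" using r M2 by (simp add: b_def abs_mult)
  then interpret nls_series b "r / 2" \<beta>
    using r M2 assms(5) c01 by unfold_locales (simp_all add: b_def \<beta>_def)
  obtain \<epsilon>1 where \<epsilon>1: "\<epsilon>1 > 0" "\<And>\<epsilon>. 0 < \<epsilon> \<Longrightarrow> \<epsilon> \<le> \<epsilon>1 \<Longrightarrow> small_param \<epsilon>"
    using small_param_ex by blast
  obtain \<delta> where \<delta>: "\<delta> > 0" "\<And>y. \<bar>y\<bar> < \<delta> \<Longrightarrow> y \<in> D"
    using assms(1,2) unfolding open_dist by (auto simp: dist_real_def)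
  \<comment> \<open>The second bound keeps $|u|^2 \le 8\varepsilon/(3\beta)$ below \<open>\<delta>\<close>, hence inside \<open>D\<close>.\<close>
  define \<epsilon>0 where "\<epsilon>0 = min \<epsilon>1 (3 * \<beta> * \<delta> / 16)"
  have \<epsilon>0: "\<epsilon>0 > 0" using \<epsilon>1 \<beta> \<delta> by (simp add: \<epsilon>0_def)
  define N where "N = int (m0\<^sup>2)"
  \<comment> \<open>The profile lives on the strip of half-width 1/2; the substitution of $m_0 x$ shrinks it by the factor $m_0$.\<close>
  define \<rho> where "\<rho> = 1 / (2 * real m0)"
  have \<rho>: "\<rho> > 0" using assms(6) by (simp add: \<rho>_def)
  \<comment> \<open>Adding 1 makes the constant positive without computing signs.\<close>
  define C where "C = \<bar>profile_const * (exp (\<rho> / 2 / 2 * \<bar>N\<bar>) * (\<Sum>\<^sub>\<infinity>m::int. exp (- (\<rho> / 2 / 2) * \<bar>m\<bar>)))\<bar> + 1"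
  have main: "\<exists>u. dirichlet_nls_solution \<phi> D u \<and>
           odd_fourier_form (1 + \<epsilon>) u \<and>
           (\<forall>t x. u (t + 2 * pi / (1 + \<epsilon>)) x = u t x) \<and>
           jointly_analytic u \<and>
           freq_norm (1 + \<epsilon>) (\<rho> / 2 / 2) (\<lambda>t x. u t x - of_real (sqrt (\<epsilon> / \<Phi>)) * wave_u0 m0 ((1 + \<epsilon>) * t) x)
             \<le> ennreal (C * \<epsilon> * sqrt \<epsilon>)" if \<epsilon>: "0 < \<epsilon>" "\<epsilon> \<le> \<epsilon>0" for \<epsilon>
  proof -
    have sp: "small_param \<epsilon>" using \<epsilon>1(2) \<epsilon> by (simp add: \<epsilon>0_def)
    define \<omega> where "\<omega> = 1 + \<epsilon>"
    have \<omega>: "\<omega> > 0" using \<epsilon> by (simp add: \<omega>_def)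
    obtain f f' where f_hol: "f holomorphic_on strip (1/2)"
      and df: "\<And>z. z \<in> strip (1/2) \<Longrightarrow> (f has_field_derivative f' z) (at z)"
      and df': "\<And>z. z \<in> strip (1/2) \<Longrightarrow>
        (f' has_field_derivative ((\<Sum>k. of_real (b k) * ((f z)\<^sup>2) ^ k) - of_real (1 + \<epsilon>)) * f z) (at z)"
      and f_per: "\<And>z. z \<in> strip (1/2) \<Longrightarrow> f (z + of_real (2*pi)) = f z"
      and f_odd: "\<And>z. z \<in> strip (1/2) \<Longrightarrow> f (- z) = - f z"
      and f_real: "\<And>x. f (of_real x) \<in> \<real>"
      and f_small: "\<And>x. (cmod (f (of_real x)))\<^sup>2 \<le> 8 * \<epsilon> / (3 * \<beta>)"
      and f_near: "\<And>z. z \<in> strip (1/2) \<Longrightarrow>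
        cmod (f z - of_real (sqrt (4 * \<epsilon> / (3 * \<beta>))) * sin z) \<le> profile_const * \<epsilon> * sqrt \<epsilon>"
      by (rule profile_exists[OF sp]) (rule that)
    interpret f: periodic_on_strip f "1/2" by unfold_locales (use f_hol f_per in auto)
    have strip_m: "of_nat m0 * z \<in> strip (1/2)" if "z \<in> strip \<rho>" for z
    proof -
      have "real m0 * \<bar>Im z\<bar> < real m0 * \<rho>" using that assms(6) by (intro mult_strict_left_mono) auto
      then show ?thesis using assms(6) by (simp add: \<rho>_def abs_mult)
    qed
    have per_m: "f (of_nat m0 * (z + of_real (2*pi))) = f (of_nat m0 * z)"
      and sin_per_m: "sin (of_nat m0 * (z + of_real (2*pi))) = sin (of_nat m0 * z)"
      if "z \<in> strip \<rho>" for z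
    proof -
      have shift: "of_nat m0 * (z + of_real (2*pi)) = of_nat m0 * z + of_real (2*pi) * of_nat m0"
        by (simp add: algebra_simps)
      show "f (of_nat m0 * (z + of_real (2*pi))) = f (of_nat m0 * z)"
        unfolding shift by (rule f.per_nat[OF strip_m[OF that]])
      interpret s: periodic_on_strip "sin" "1/2"
      proof
        show "sin holomorphic_on strip (1/2)" by (rule holomorphic_on_sin)
      qed (simp, rule sin_plus_2pi_complex)
      show "sin (of_nat m0 * (z + of_real (2*pi))) = sin (of_nat m0 * z)"
        unfolding shift by (rule s.per_nat[OF strip_m[OF that]])
    qed
    define u where "u = (\<lambda>t x. \<i> * exp (\<i> * of_real (real (m0\<^sup>2) * (\<omega> * t))) * f (of_real (real m0 * x)))"
    define v where "v z = f (of_nat m0 * z)" for z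
    have u_v: "u = (\<lambda>t x. \<i> * exp (\<i> * of_real (of_int N * (\<omega> * t))) * v (of_real x))"
      by (simp add: u_def v_def N_def)
    have v_hol: "v holomorphic_on strip \<rho>"
      unfolding v_def by (intro holomorphic_on_compose_gen[OF _ f_hol, unfolded o_def] holomorphic_intros) (use strip_m in blast)
    have v: "periodic_on_strip v \<rho>"
      by unfold_locales (use \<rho> v_hol per_m in \<open>auto simp: v_def\<close>)
    have odd_v: "v (of_real (- x)) = - v (of_real x)" for x
      using f_odd[of "of_nat m0 * of_real x"] by (simp add: v_def)
    have "dirichlet_nls_solution \<phi> D u"
      unfolding u_def
    proof (rule rotating_wave_is_solution[where \<rho> = "1/2" and g = "\<lambda>z. \<Sum>k. of_real (b k) * ((f z)\<^sup>2) ^ k"])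
      show "of_nat (m0\<^sup>2) * (\<Sum>k. of_real (b k) * ((f (of_real x))\<^sup>2) ^ k) = of_real (\<phi> ((cmod (f (of_real x)))\<^sup>2))" for x
      proof -
        obtain y where y: "f (of_real x) = of_real y" using f_real[of x] by (auto elim: Reals_cases)
        have "y\<^sup>2 \<le> 8 * \<epsilon> / (3 * \<beta>)" using f_small[of x] by (simp add: y)
        moreover have "8 * \<epsilon> / (3 * \<beta>) * 9 \<le> r / 2" using sp by (simp add: small_param_def)
        ultimately have "\<bar>y\<^sup>2\<bar> < r" using r by (simp only: abs_of_nonneg[OF zero_le_power2])
        from sums_of_real[OF sums_divide[OF ser[OF this], of M2], where ?'a = complex]
        have "(\<lambda>k. of_real (b k) * ((f (of_real x))\<^sup>2) ^ k) sums of_real (\<phi> (y\<^sup>2) / M2)"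
          by (simp add: b_def y)
        then have "(\<Sum>k. of_real (b k) * ((f (of_real x))\<^sup>2) ^ k) = of_real (\<phi> (y\<^sup>2) / M2)" by (simp add: sums_iff)
        then show ?thesis using M2 by (simp add: y M2_def)
      qed
      show "(cmod (f (of_real x)))\<^sup>2 \<in> D" for x
      proof (rule \<delta>(2))
        have "8 * \<epsilon> / (3 * \<beta>) \<le> \<delta> / 2" using \<epsilon> \<beta> by (simp add: \<epsilon>0_def field_simps)
        then show "\<bar>(cmod (f (of_real x)))\<^sup>2\<bar> < \<delta>" using f_small[of x] \<delta>(1) by simp
      qed
      show f0: "f 0 = 0" using f_odd[of 0] by simp
      have "f (- of_real (real m0 * pi) + of_real (2*pi) * of_nat m0) = f (- of_real (real m0 * pi))"
        by (rule f.per_nat) simp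
      moreover have "- of_real (real m0 * pi) + of_real (2*pi) * of_nat m0 = (of_real (real m0 * pi) :: complex)"
        by (simp add: algebra_simps)
      ultimately have "f (of_real (real m0 * pi)) = f (- of_real (real m0 * pi))" by (simp only:)
      also have "\<dots> = - f (of_real (real m0 * pi))" by (rule f_odd) simp
      finally show "f (of_real (real m0 * pi)) = 0" by simp
    qed (use df df' assms(6) in \<open>auto simp: \<omega>_def\<close>)
    moreover have "odd_fourier_form \<omega> u"
      unfolding u_v by (rule odd_fourier_form_single_frequency[OF v odd_v])
    moreover have "u (t + 2 * pi / \<omega>) x = u t x" for t x
    proof -
      have "\<i> * of_real (real (m0\<^sup>2) * (\<omega> * (t + 2 * pi / \<omega>)))
          = \<i> * of_real (real (m0\<^sup>2) * (\<omega> * t)) + of_real (2 * pi) * \<i> * of_nat (m0\<^sup>2)"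
        using \<omega> by (simp add: algebra_simps)
      moreover have "exp (of_real (2 * pi) * \<i> * of_nat (m0\<^sup>2)) = 1"
        using exp_integer_2pi[of "of_nat (m0\<^sup>2)"] by (simp add: mult_ac)
      ultimately show ?thesis unfolding u_def by (simp only: exp_add mult_1_right)
    qed
    moreover have "jointly_analytic u"
    proof -
      have "u = (\<lambda>t x. \<i> * exp (\<i> * of_real ((real (m0\<^sup>2) * \<omega>) * t)) * v (of_real x))"
        by (simp add: u_def v_def mult_ac)
      then show ?thesis by (simp only: jointly_analytic_exp_times_holomorphic[OF \<rho> v_hol])
    qed
    moreover have "freq_norm \<omega> (\<rho> / 2 / 2) (\<lambda>t x. u t x - of_real (sqrt (\<epsilon> / \<Phi>)) * wave_u0 m0 (\<omega> * t) x)
             \<le> ennreal (C * \<epsilon> * sqrt \<epsilon>)"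
    proof -
      define a0 where "a0 = sqrt (4 * \<epsilon> / (3 * \<beta>))"
      have a0: "a0 = sqrt (\<epsilon> / \<Phi>) * (2 * real m0 / sqrt 3)"
      proof -
        have "4 * \<epsilon> / (3 * \<beta>) = \<epsilon> / \<Phi> * ((2 * real m0)\<^sup>2 / 3)"
          by (simp add: \<beta>_def M2_def power_mult_distrib)
        then show ?thesis unfolding a0_def by (simp only: real_sqrt_mult[of "\<epsilon> / \<Phi>"] real_sqrt_divide[of "(2 * real m0)\<^sup>2"] real_sqrt_abs)
      qed
      define d where "d z = v z - of_real a0 * sin (of_nat m0 * z)" for z
      have "(\<lambda>t x. u (t / \<omega>) x - of_real (sqrt (\<epsilon> / \<Phi>)) * wave_u0 m0 (\<omega> * (t / \<omega>)) x)
        = (\<lambda>t x. \<i> * exp (\<i> * of_real (of_int N * t)) * d (of_real x))"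
        using \<omega> unfolding u_v wave_u0_eq d_def a0 by (simp add: N_def algebra_simps)
      then have eq: "freq_norm \<omega> (\<rho> / 2 / 2) (\<lambda>t x. u t x - of_real (sqrt (\<epsilon> / \<Phi>)) * wave_u0 m0 (\<omega> * t) x)
        = fourier_norm (\<rho> / 2 / 2) (\<lambda>t x. \<i> * exp (\<i> * of_real (of_int N * t)) * d (of_real x))"
        by (simp add: freq_norm_def)
      interpret d: periodic_on_strip d \<rho>
      proof
        show "d holomorphic_on strip \<rho>" unfolding d_def by (intro holomorphic_intros v_hol)
        show "d (z + of_real (2*pi)) = d z" if "z \<in> strip \<rho>" for z
          unfolding d_def v_def per_m[OF that] sin_per_m[OF that] ..
      qed (rule \<rho>)
      have dec: "cmod (fcoeff d m) \<le> (profile_const * \<epsilon> * sqrt \<epsilon>) * exp (- (\<rho> / 2) * \<bar>m\<bar>)" for m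
      proof (rule d.fcoeff_decay)
        show "cmod (d z) \<le> profile_const * \<epsilon> * sqrt \<epsilon>" if "\<bar>Im z\<bar> = \<rho> / 2" for z
          unfolding d_def v_def a0_def by (rule f_near[OF strip_m]) (use that \<rho> in simp)
      qed (use \<rho> in auto)
      let ?X = "exp (\<rho> / 2 / 2 * \<bar>N\<bar>) * (\<Sum>\<^sub>\<infinity>m::int. exp (- (\<rho> / 2 / 2) * \<bar>m\<bar>))"
      have "freq_norm \<omega> (\<rho> / 2 / 2) (\<lambda>t x. u t x - of_real (sqrt (\<epsilon> / \<Phi>)) * wave_u0 m0 (\<omega> * t) x)
          \<le> ennreal (profile_const * \<epsilon> * sqrt \<epsilon> * ?X)"
        unfolding eq by (rule fourier_norm_single_frequency_le[OF _ dec]) (use \<rho> in simp)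
      also have "\<dots> \<le> ennreal (C * \<epsilon> * sqrt \<epsilon>)"
      proof (rule ennreal_leI)
        have "profile_const * ?X * (\<epsilon> * sqrt \<epsilon>) \<le> C * (\<epsilon> * sqrt \<epsilon>)"
          using \<epsilon> by (intro mult_right_mono) (auto simp: C_def)
        then show "profile_const * \<epsilon> * sqrt \<epsilon> * ?X \<le> C * \<epsilon> * sqrt \<epsilon>" by (simp only: mult_ac)
      qed
      finally show ?thesis .
    qed
    ultimately show ?thesis unfolding \<omega>_def by blast
  qed
  have density: "((\<lambda>\<epsilon>. measure lebesgue ({0<..\<epsilon>0} \<inter> {0..\<epsilon>}) / \<epsilon>) \<longlongrightarrow> 1) (at_right (0::real))"
  proof (rule tendsto_eventually)
    show "eventually (\<lambda>\<epsilon>. measure lebesgue ({0<..\<epsilon>0} \<inter> {0..\<epsilon>}) / \<epsilon> = 1) (at_right (0::real))"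
      using eventually_at_right_real[OF \<epsilon>0]
    proof eventually_elim
      case (elim \<epsilon>)
      then have "{0<..\<epsilon>0} \<inter> {0..\<epsilon>} = {0<..\<epsilon>}" by auto
      then show ?case using elim by simp
    qed
  qed
  have "C > 0" "\<rho> / 2 / 2 > 0" using \<rho> by (auto simp: C_def)
  show ?thesis
  proof (rule exI[of _ \<epsilon>0], rule conjI[OF \<epsilon>0], rule exI[of _ "{0<..\<epsilon>0}"], intro conjI density)
    show "\<exists>C>0. \<exists>\<kappa>>0. \<forall>\<epsilon>\<in>{0<..\<epsilon>0}. let \<omega> = 1 + \<epsilon> in
       \<exists>u. dirichlet_nls_solution \<phi> D u \<and>
           odd_fourier_form \<omega> u \<and>
           (\<forall>t x. u (t + 2 * pi / \<omega>) x = u t x) \<and>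
           jointly_analytic u \<and>
           freq_norm \<omega> \<kappa> (\<lambda>t x. u t x - of_real (sqrt (\<epsilon> / \<Phi>)) * wave_u0 m0 (\<omega> * t) x)
             \<le> ennreal (C * \<epsilon> * sqrt \<epsilon>)"
      unfolding Let_def
      by (rule exI[of _ C], rule conjI[OF \<open>C > 0\<close>], rule exI[of _ "\<rho> / 2 / 2"],
          rule conjI[OF \<open>\<rho> / 2 / 2 > 0\<close>]) (use main in simp)
  qed auto
qed

end
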